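(* For $\diamond\in\{\mathrm d,\mathrm p\}$ and $\#\in\{\mathrm{ET},\mathrm{ST}\}$, there exists a positive constant $\mathrm{MIET}^\diamond$ such that, for $\tau\le\mathrm{MIET}^\diamond$, the Adaptive High-Order-Hold Algorithm (with stepsize rule $\mathfrak{step}^\diamond_\#$ and stepsize lower bound parameter $\tau$) has the following properties: (i) it is executable, i.e., at each iteration, the parameter $a$ is determined in a finite number of steps; (ii) the stepsize $\Delta_k$ is uniformly lower bounded by $\tau$; (iii) it satisfies $f(x_{k+1})-f(x_* )=\mathcal O\big(e^{-\frac{\sqrt\mu}{4}\sum_{i=0}^k\Delta_i}\big)$ for $k\in\{0\}\cup\mathbb{N}$.
   Context: Let $\mu,L,s>0$, and let $f:\mathbb{R}^n\to\mathbb{R}$ be continuously differentiable, $\mu$-strongly convex (i.e. $f(y)-f(x)\ge\langle\nabla f(x),y-x\rangle+\frac{\mu}{2}\|x-y\|^2$ for all $x,y$), with $L$-Lipschitz gradient; $x_*$ is its unique minimizer. Norms are Euclidean. Notation: $\sqrt{\mu_s}=1+\sqrt{\mu s}$, so $\mu_s=(1+\sqrt{\mu s})^2$. For $a\ge0$ and $\hat p=[\hat x,\hat v]^T\in\mathbb{R}^n\times\mathbb{R}^n$ write $\hat g=\nabla f(\hat x+a\hat v)$ and $W=\|2\sqrt\mu\hat v+\sqrt{\mu_s}\hat g\|$. The high-order-hold integrator trajectory from $\hat p$ (with parameter $a$) is the solution $p(t)=[x(t),v(t)]^T$ of $\dot x=v$, $\dot v=-2\sqrt\mu v-\sqrt{\mu_s}\,\hat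 g$ with $(x(0),v(0))=(\hat x,\hat v)$, namely $$x(t)=\hat x-\frac{\sqrt{\mu_s}\,\hat g\,t}{2\sqrt\mu}+(1-e^{-2\sqrt\mu t})\frac{\sqrt{\mu_s}\,\hat g+2\sqrt\mu\hat v}{4\mu},\qquad v(t)=e^{-2\sqrt\mu t}\hat v+(e^{-2\sqrt\mu t}-1)\frac{\sqrt{\mu_s}\,\hat g}{2\sqrt\mu}.$$ Define $$\mathfrak b^{\mathrm d}_{\mathrm{ET}}(\hat p,t;a)=\mathfrak A_{\mathrm{ET}}(\hat p,t;a)+\mathfrak B_{\mathrm{ET}}(\hat p,t;a)+\mathfrak C_{\mathrm{ET}}(\hat p;a)+\mathfrak D_{\mathrm{ET}}(\hat p,t;a),$$ $$\mathfrak b^{\mathrm d}_{\mathrm{ST}}(\hat p,t;a)=(\mathfrak A^q_{\mathrm{ST}}+\mathfrak B^q_{\mathrm{ST}})(\hat p;a)\,t^2+(\mathfrak A^l_{\mathrm{ST}}+\mathfrak B^l_{\mathrm{ST}}+\mathfrak D_{\mathrm{ST}})(\hat p;a)\,t+\mathfrak C_{\mathrm{ST}}(\hat p;a),$$ where $$\mathfrak A_{\mathrm{ET}}(\hat p,t;a)=\sqrt{\mu_s}\big(\langle\nabla f(x(t))-\nabla f(\hat x),v(t)\rangle-\langle v(t)-\hat v,\hat g\rangle-\sqrt\mu\langle x(t)-\hat x,\hat g\rangle\big)-\sqrt\mu\langle v(t)-\hat v,v(t)\rangle,$$ $$\mathfrak B_{\mathrm{ET}}(\hat p,t;a)=\frac{\sqrt\mu}{4}\Big(\sqrt{\mu_s}(f(x(t))-f(\hat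 x))-\sqrt\mu\sqrt{\mu_s}\,t\frac{\|\hat g\|^2}{L}+\sqrt\mu\sqrt{\mu_s}\,t\langle\hat g,a\hat v\rangle+\frac14(\|v(t)\|^2-\|\hat v\|^2)+\frac14\|v(t)-\hat v+2\sqrt\mu(x(t)-\hat x)\|^2+\frac12\langle v(t)-\hat v+2\sqrt\mu(x(t)-\hat x),\hat v\rangle\Big),$$ $$\mathfrak C_{\mathrm{ET}}(\hat p;a)=\mathfrak C_{\mathrm{ST}}(\hat p;a)=-\frac{13\sqrt\mu}{16}\|\hat v\|^2-\frac{\mu^2\sqrt s}{2}\frac{\|\nabla f(\hat x)\|^2}{L^2}+\sqrt{\mu_s}\Big(-\frac{3\sqrt\mu}{8L}\|\nabla f(\hat x)\|^2+\sqrt\mu(f(\hat x)-f(\hat x+a\hat v))+\sqrt\mu\|\nabla f(\hat x)\|\|a\hat v\|-\frac{\mu^{3/2}}{2}\|a\hat v\|^2-\langle\hat g-\nabla f(\hat x),\hat v\rangle+\sqrt\mu\langle\hat g,a\hat v\rangle\Big),$$ $$\mathfrak D_{\mathrm{ET}}(\hat p,t;a)=\sqrt{\mu_s}\langle\nabla f(\hat x),v(t)-\hat v\rangle-\sqrt\mu\langle\hat v,v(t)-\hat v\rangle,$$ $$\mathfrak A^l_{\mathrm{ST}}(\hat p;a)=W\Big(\sqrt\mu\|\hat v\|+\frac{L\sqrt{\mu_s}}{2\sqrt\mu}\|\hat v\|+\frac{3\sqrt{\mu_s}}{2}\|\hat g\|\Big)+\frac{\mu_s}{2}\|\hat g\|\Big(\frac{L}{\sqrt\mu}\|\hat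 v\|+\|\hat g\|\Big),$$ $$\mathfrak A^q_{\mathrm{ST}}(\hat p;a)=W\Big(\Big(\frac{L\sqrt{\mu_s}}{2\sqrt\mu}+\sqrt\mu\Big)W+\frac{L\mu_s}{2\sqrt\mu}\|\hat g\|\Big),$$ $$\mathfrak B^l_{\mathrm{ST}}(\hat p;a)=\frac{\sqrt\mu\sqrt{\mu_s}}{4}\Big(\frac{\sqrt{\mu_s}}{2\sqrt\mu}\|\hat g\|\|\nabla f(\hat x)\|+\frac12W\Big(\frac{\|\nabla f(\hat x)\|}{\sqrt\mu}+\frac{\|\hat v\|}{\sqrt{\mu_s}}\Big)-\sqrt\mu\frac{\|\hat g\|^2}{L}+\Big(a\sqrt\mu-\frac12\Big)\langle\hat g,\hat v\rangle\Big),$$ $$\mathfrak B^q_{\mathrm{ST}}(\hat p;a)=\frac{10\mu^2+L^2\sqrt{\mu_s}}{32\mu^{3/2}}W^2+\frac{\mu_s(4\mu^2+L^2\sqrt{\mu_s})}{32\mu^{3/2}}\|\hat g\|^2+\frac{\sqrt{\mu_s}(4\mu^2+L^2\sqrt{\mu_s})}{16\mu^{3/2}}W\|\hat g\|,$$ $$\mathfrak D_{\mathrm{ST}}(\hat p;a)=W\big(\sqrt{\mu_s}\|\nabla f(\hat x)\|+\sqrt\mu\|\hat v\|\big).$$ Further, $\mathfrak b^{\mathrm p}_{\#}(\hat p,t;a)=\int_0^te^{\frac{\sqrt\mu}{4}\zeta}\mathfrak b^{\mathrm d}_{\#}(\hat p,\zeta;a)\,d\zeta$, and the stepsizes are $\mathfrak{step}^\diamond_\#(\hat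 p;a)=\min\{t>0:\mathfrak b^\diamond_\#(\hat p,t;a)=0\}$ for $\diamond\in\{\mathrm d,\mathrm p\}$, $\#\in\{\mathrm{ET},\mathrm{ST}\}$. Adaptive High-Order-Hold Algorithm: the inputs are an initial point $p_0=[x_0,v_0]^T$, a tolerance $\epsilon>0$, an increase rate $r_i>1$, a decrease rate $0<r_d<1$, a stepsize lower bound parameter $\tau$, and an initial value $a\ge0$; start with $k=0$. While $\|\nabla f(x_k)\|\ge\epsilon$, perform the following iteration. (1) Starting from the current value of $a$, repeatedly replace $a$ by $a\,r_d$ as long as either $\mathfrak C_\#(p_k;a)\ge0$, or $\mathfrak C_\#(p_k;a)<0$ and $\mathfrak{step}^\diamond_\#(p_k;a)<\tau$; stop at the first value of $a$ with $\mathfrak C_\#(p_k;a)<0$ and $\mathfrak{step}^\diamond_\#(p_k;a)\ge\tau$. (2) Set $\Delta_k=\mathfrak{step}^\diamond_\#(p_k;a)$ and let $p_{k+1}=[x_{k+1},v_{k+1}]^T$ be the value at time $\Delta_k$ of the high-order-hold integrator trajectory from $\hat p=p_k$ with parameter $a$. (3) Increase $k$ by one and, if no decrease of $a$ took place in (1), replace $a$ by $a\,r_i$. Assertions indexed by $k$ refer to the iterations actually performed. The $\mathcal O(\cdot)$ means an upper bound by a constant independent of $k$ times the given expression. The constant $\mathrm{MIET}^\diamond$ may depend on $\mu,L,s$ but not on the state or the iteration. *)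

theory Defs
  imports "HOL-Analysis.Analysis"
begin

definition grad :: "('a::euclidean_space \<Rightarrow> real) \<Rightarrow> 'a \<Rightarrow> 'a" where
  "grad f x = (THE D. GDERIV f x :> D)"

lemma GDERIV_grad:
  fixes f :: "'a::euclidean_space \<Rightarrow> real"
  assumes "f differentiable (at x)"
  shows "GDERIV f x :> grad f x"
proof -
  obtain f' where f': "(f has_derivative f') (at x)"
    using assms by (auto simp: differentiable_def)
  define D where "D = adjoint f' 1"
  have "f' = (\<lambda>h. h \<bullet> D)"
    using adjoint_works[OF has_derivative_linear[OF f'], of _ 1] by (auto simp: D_def)
  then have D: "GDERIV f x :> D"
    using f' by (simp only: gderiv_def)
  have "E = D" if "GDERIV f x :> E" for E
  proof -
    have "(\<lambda>h. h \<bullet> E) = (\<lambda>h. h \<bullet> D)"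
      using that D has_derivative_unique unfolding gderiv_def by blast
    then have "\<forall>h. h \<bullet> E = h \<bullet> D" by (rule fun_cong[THEN allI])
    then show ?thesis by (simp only: vector_eq_ldot)
  qed
  with D show ?thesis unfolding grad_def by (rule theI)
qed

definition strongly_convex :: "real \<Rightarrow> ('a::euclidean_space \<Rightarrow> real) \<Rightarrow> bool" where
  "strongly_convex \<mu> f \<longleftrightarrow>
    (\<forall>x y. f y - f x \<ge> grad f x \<bullet> (y - x) + \<mu> / 2 * (norm (x - y))\<^sup>2)"

definition mu_s :: "real \<Rightarrow> real \<Rightarrow> real" where
  "mu_s \<mu> s = (1 + sqrt (\<mu> * s))\<^sup>2"

datatype bound = ET | ST

text \<open>\<open>Deriv\<close> is the superscript d (the bound on the derivative itself), \<open>Perf\<close> the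
  superscript p (its exponentially weighted integral).\<close>
datatype trigger = Deriv | Perf

context
  fixes \<mu> L s :: real and f :: "'a::euclidean_space \<Rightarrow> real"
begin

definition hoh_x :: "'a \<Rightarrow> 'a \<Rightarrow> real \<Rightarrow> real \<Rightarrow> 'a" where
  "hoh_x x v a t = (let g = grad f (x + a *\<^sub>R v) in
     x - (sqrt (mu_s \<mu> s) * t / (2 * sqrt \<mu>)) *\<^sub>R g
       + ((1 - exp (- 2 * sqrt \<mu> * t)) / (4 * \<mu>)) *\<^sub>R (sqrt (mu_s \<mu> s) *\<^sub>R g + (2 * sqrt \<mu>) *\<^sub>R v))"

definition hoh_v :: "'a \<Rightarrow> 'a \<Rightarrow> real \<Rightarrow> real \<Rightarrow> 'a" where
  "hoh_v x v a t = (let g = grad f (x + a *\<^sub>R v) in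
     exp (- 2 * sqrt \<mu> * t) *\<^sub>R v + ((exp (- 2 * sqrt \<mu> * t) - 1) * sqrt (mu_s \<mu> s) / (2 * sqrt \<mu>)) *\<^sub>R g)"

lemma hoh_initial: "hoh_x x v a 0 = x" "hoh_v x v a 0 = v"
  by (simp_all add: hoh_x_def hoh_v_def)

lemma hoh_ode:
  assumes "\<mu> > 0"
  shows "(hoh_x x v a has_vector_derivative hoh_v x v a t) (at t)"
    and "(hoh_v x v a has_vector_derivative
           - (2 * sqrt \<mu>) *\<^sub>R hoh_v x v a t - sqrt (mu_s \<mu> s) *\<^sub>R grad f (x + a *\<^sub>R v)) (at t)"
proof -
  define c where "c = sqrt \<mu>"
  have c: "\<mu> = c * c" "c \<noteq> 0" "sqrt \<mu> = c" using assms by (auto simp: c_def)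
  define g where "g = grad f (x + a *\<^sub>R v)"
  define q where "q = sqrt (mu_s \<mu> s)"
  define E where "E = exp (- 2 * c * t)"
  note defs = hoh_x_def[abs_def] hoh_v_def[abs_def] Let_def g_def[symmetric] q_def[symmetric] c(3)
  have sc: "((\<lambda>t. \<phi> t *\<^sub>R w) has_vector_derivative \<phi>' *\<^sub>R w) (at t)"
    if "(\<phi> has_real_derivative \<phi>') (at t)" for \<phi> \<phi>' and w :: 'a
    using has_vector_derivative_scaleR[OF that has_vector_derivative_const] by simp
  have E: "((\<lambda>t. exp (- 2 * c * t)) has_real_derivative - 2 * c * E) (at t)"
    unfolding E_def by (auto intro!: derivative_eq_intros)
  have "((\<lambda>t. (q * t / (2 * c))) has_real_derivative q / (2 * c)) (at t)"
    using c(2) by (auto intro!: derivative_eq_intros)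
  moreover have "((\<lambda>t. (1 - exp (- 2 * c * t)) / (4 * \<mu>)) has_real_derivative E / (2 * c)) (at t)"
    using c(2) by (auto intro!: derivative_eq_intros simp: c(1) E_def)
  ultimately have "((\<lambda>t. x - (q * t / (2 * c)) *\<^sub>R g
           + ((1 - exp (- 2 * c * t)) / (4 * \<mu>)) *\<^sub>R (q *\<^sub>R g + (2 * c) *\<^sub>R v))
         has_vector_derivative
         0 - (q / (2 * c)) *\<^sub>R g + (E / (2 * c)) *\<^sub>R (q *\<^sub>R g + (2 * c) *\<^sub>R v)) (at t)"
    by (intro has_vector_derivative_add has_vector_derivative_diff has_vector_derivative_const sc)
  also have "0 - (q / (2 * c)) *\<^sub>R g + (E / (2 * c)) *\<^sub>R (q *\<^sub>R g + (2 * c) *\<^sub>R v)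
      = E *\<^sub>R v + ((E - 1) * q / (2 * c)) *\<^sub>R g"
    using c(2) by (simp add: scaleR_add_right left_diff_distrib diff_divide_distrib scaleR_diff_left)
  finally show "(hoh_x x v a has_vector_derivative hoh_v x v a t) (at t)"
    unfolding defs E_def .
  have "((\<lambda>t. (exp (- 2 * c * t) - 1) * q / (2 * c)) has_real_derivative - E * q) (at t)"
    using c(2) by (auto intro!: derivative_eq_intros simp: E_def)
  then have "((\<lambda>t. exp (- 2 * c * t) *\<^sub>R v + ((exp (- 2 * c * t) - 1) * q / (2 * c)) *\<^sub>R g)
         has_vector_derivative (- 2 * c * E) *\<^sub>R v + (- E * q) *\<^sub>R g) (at t)"
    by (intro has_vector_derivative_add sc E)
  moreover have "(- 2 * c * E) *\<^sub>R v + (- E * q) *\<^sub>R g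
      = - (2 * c) *\<^sub>R (E *\<^sub>R v + ((E - 1) * q / (2 * c)) *\<^sub>R g) - q *\<^sub>R g"
  proof -
    have "- E * q = - (2 * c) * ((E - 1) * q / (2 * c)) - q"
      using c(2) by (simp add: left_diff_distrib)
    moreover have "- 2 * c * E = - (2 * c) * E" by simp
    ultimately show ?thesis
      by (simp only: scaleR_add_right scaleR_scaleR scaleR_diff_left add_diff_eq)
  qed
  ultimately show "(hoh_v x v a has_vector_derivative
           - (2 * sqrt \<mu>) *\<^sub>R hoh_v x v a t - sqrt (mu_s \<mu> s) *\<^sub>R grad f (x + a *\<^sub>R v)) (at t)"
    unfolding defs E_def by (simp only:)
qed

definition A_ET :: "'a \<Rightarrow> 'a \<Rightarrow> real \<Rightarrow> real \<Rightarrow> real" where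
  "A_ET x v a t = (let g = grad f (x + a *\<^sub>R v); xt = hoh_x x v a t; vt = hoh_v x v a t in
     sqrt (mu_s \<mu> s) * ((grad f xt - grad f x) \<bullet> vt - (vt - v) \<bullet> g - sqrt \<mu> * ((xt - x) \<bullet> g))
     - sqrt \<mu> * ((vt - v) \<bullet> vt))"

definition B_ET :: "'a \<Rightarrow> 'a \<Rightarrow> real \<Rightarrow> real \<Rightarrow> real" where
  "B_ET x v a t = (let g = grad f (x + a *\<^sub>R v); xt = hoh_x x v a t; vt = hoh_v x v a t;
       w = vt - v + (2 * sqrt \<mu>) *\<^sub>R (xt - x) in
     sqrt \<mu> / 4 * (sqrt (mu_s \<mu> s) * (f xt - f x) - sqrt \<mu> * sqrt (mu_s \<mu> s) * t * ((norm g)\<^sup>2 / L)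
       + sqrt \<mu> * sqrt (mu_s \<mu> s) * t * (g \<bullet> (a *\<^sub>R v))
       + 1 / 4 * ((norm vt)\<^sup>2 - (norm v)\<^sup>2) + 1 / 4 * (norm w)\<^sup>2 + 1 / 2 * (w \<bullet> v)))"

definition C_bd :: "'a \<Rightarrow> 'a \<Rightarrow> real \<Rightarrow> real" where
  "C_bd x v a = (let g = grad f (x + a *\<^sub>R v) in
     - (13 * sqrt \<mu> / 16) * (norm v)\<^sup>2 - \<mu>\<^sup>2 * sqrt s / 2 * ((norm (grad f x))\<^sup>2 / L\<^sup>2)
     + sqrt (mu_s \<mu> s) * (- (3 * sqrt \<mu> / (8 * L)) * (norm (grad f x))\<^sup>2 + sqrt \<mu> * (f x - f (x + a *\<^sub>R v))
        + sqrt \<mu> * norm (grad f x) * norm (a *\<^sub>R v) - \<mu> powr (3/2) / 2 * (norm (a *\<^sub>R v))\<^sup>2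
        - (g - grad f x) \<bullet> v + sqrt \<mu> * (g \<bullet> (a *\<^sub>R v))))"

definition D_ET :: "'a \<Rightarrow> 'a \<Rightarrow> real \<Rightarrow> real \<Rightarrow> real" where
  "D_ET x v a t = (let vt = hoh_v x v a t in sqrt (mu_s \<mu> s) * (grad f x \<bullet> (vt - v)) - sqrt \<mu> * (v \<bullet> (vt - v)))"

definition W_ST :: "'a \<Rightarrow> 'a \<Rightarrow> real \<Rightarrow> real" where
  "W_ST x v a = norm ((2 * sqrt \<mu>) *\<^sub>R v + sqrt (mu_s \<mu> s) *\<^sub>R grad f (x + a *\<^sub>R v))"

definition Al_ST :: "'a \<Rightarrow> 'a \<Rightarrow> real \<Rightarrow> real" where
  "Al_ST x v a = (let g = grad f (x + a *\<^sub>R v) in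
     W_ST x v a * (sqrt \<mu> * norm v + L * sqrt (mu_s \<mu> s) / (2 * sqrt \<mu>) * norm v + 3 * sqrt (mu_s \<mu> s) / 2 * norm g)
     + mu_s \<mu> s / 2 * norm g * (L / sqrt \<mu> * norm v + norm g))"

definition Aq_ST :: "'a \<Rightarrow> 'a \<Rightarrow> real \<Rightarrow> real" where
  "Aq_ST x v a = (let g = grad f (x + a *\<^sub>R v) in
     W_ST x v a * ((L * sqrt (mu_s \<mu> s) / (2 * sqrt \<mu>) + sqrt \<mu>) * W_ST x v a + L * mu_s \<mu> s / (2 * sqrt \<mu>) * norm g))"

definition Bl_ST :: "'a \<Rightarrow> 'a \<Rightarrow> real \<Rightarrow> real" where
  "Bl_ST x v a = (let g = grad f (x + a *\<^sub>R v) in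
     sqrt \<mu> * sqrt (mu_s \<mu> s) / 4 * (sqrt (mu_s \<mu> s) / (2 * sqrt \<mu>) * norm g * norm (grad f x)
       + 1 / 2 * W_ST x v a * (norm (grad f x) / sqrt \<mu> + norm v / sqrt (mu_s \<mu> s))
       - sqrt \<mu> * ((norm g)\<^sup>2 / L) + (a * sqrt \<mu> - 1 / 2) * (g \<bullet> v)))"

definition Bq_ST :: "'a \<Rightarrow> 'a \<Rightarrow> real \<Rightarrow> real" where
  "Bq_ST x v a = (let g = grad f (x + a *\<^sub>R v) in
     (10 * \<mu>\<^sup>2 + L\<^sup>2 * sqrt (mu_s \<mu> s)) / (32 * \<mu> powr (3/2)) * (W_ST x v a)\<^sup>2
     + mu_s \<mu> s * (4 * \<mu>\<^sup>2 + L\<^sup>2 * sqrt (mu_s \<mu> s)) / (32 * \<mu> powr (3/2)) * (norm g)\<^sup>2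
     + sqrt (mu_s \<mu> s) * (4 * \<mu>\<^sup>2 + L\<^sup>2 * sqrt (mu_s \<mu> s)) / (16 * \<mu> powr (3/2)) * W_ST x v a * norm g)"

definition D_ST :: "'a \<Rightarrow> 'a \<Rightarrow> real \<Rightarrow> real" where
  "D_ST x v a = W_ST x v a * (sqrt (mu_s \<mu> s) * norm (grad f x) + sqrt \<mu> * norm v)"

fun b_d :: "bound \<Rightarrow> 'a \<Rightarrow> 'a \<Rightarrow> real \<Rightarrow> real \<Rightarrow> real" where
  "b_d ET x v a t = A_ET x v a t + B_ET x v a t + C_bd x v a + D_ET x v a t"
| "b_d ST x v a t = (Aq_ST x v a + Bq_ST x v a) * t\<^sup>2
     + (Al_ST x v a + Bl_ST x v a + D_ST x v a) * t + C_bd x v a"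

fun b_fun :: "trigger \<Rightarrow> bound \<Rightarrow> 'a \<Rightarrow> 'a \<Rightarrow> real \<Rightarrow> real \<Rightarrow> real" where
  "b_fun Deriv bnd x v a t = b_d bnd x v a t"
| "b_fun Perf bnd x v a t = integral {0..t} (\<lambda>\<zeta>. exp (sqrt \<mu> / 4 * \<zeta>) * b_d bnd x v a \<zeta>)"

text \<open>The stepsize, a minimum, is kept relational: no value is invented when the set of
  positive zeros has no least element.\<close>
definition is_step :: "trigger \<Rightarrow> bound \<Rightarrow> 'a \<Rightarrow> 'a \<Rightarrow> real \<Rightarrow> real \<Rightarrow> bool" where
  "is_step trg bnd x v a \<Delta> \<longleftrightarrow> \<Delta> > 0 \<and> b_fun trg bnd x v a \<Delta> = 0 \<and>
     (\<forall>t>0. b_fun trg bnd x v a t = 0 \<longrightarrow> \<Delta> \<le> t)"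

definition accepts :: "trigger \<Rightarrow> bound \<Rightarrow> real \<Rightarrow> 'a \<Rightarrow> 'a \<Rightarrow> real \<Rightarrow> bool" where
  "accepts trg bnd \<tau> x v a \<longleftrightarrow>
     C_bd x v a < 0 \<and> (\<exists>\<Delta>. is_step trg bnd x v a \<Delta> \<and> \<Delta> \<ge> \<tau>)"

definition rejects :: "trigger \<Rightarrow> bound \<Rightarrow> real \<Rightarrow> 'a \<Rightarrow> 'a \<Rightarrow> real \<Rightarrow> bool" where
  "rejects trg bnd \<tau> x v a \<longleftrightarrow>
     C_bd x v a \<ge> 0 \<or> C_bd x v a < 0 \<and> (\<exists>\<Delta>. is_step trg bnd x v a \<Delta> \<and> \<Delta> < \<tau>)"

text \<open>Started at the value \<open>a\<close>, the search for the parameter stops after exactly \<open>m\<close> decreases.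
  It gets stuck, rather than continuing, at a value whose stepsize is needed but undefined.\<close>
definition search_stops :: "trigger \<Rightarrow> bound \<Rightarrow> real \<Rightarrow> real \<Rightarrow> 'a \<Rightarrow> 'a \<Rightarrow> real \<Rightarrow> nat \<Rightarrow> bool" where
  "search_stops trg bnd \<tau> rd x v a m \<longleftrightarrow>
     (\<forall>j<m. rejects trg bnd \<tau> x v (a * rd ^ j)) \<and> accepts trg bnd \<tau> x v (a * rd ^ m)"

text \<open>The first \<open>N\<close> iterations are performed, with states \<open>(X k, V k)\<close>, stepsizes \<open>H k\<close>, and
  \<open>P k\<close> the current value of the parameter \<open>a\<close> at the start of iteration \<open>k\<close>; entries beyond
  the \<open>N\<close>-th iteration are irrelevant.\<close>
definition hoh_run :: "trigger \<Rightarrow> bound \<Rightarrow> 'a \<Rightarrow> 'a \<Rightarrow> real \<Rightarrow> real \<Rightarrow> real \<Rightarrow> real \<Rightarrow> real \<Rightarrow> nat \<Rightarrow>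
    (nat \<Rightarrow> 'a) \<Rightarrow> (nat \<Rightarrow> 'a) \<Rightarrow> (nat \<Rightarrow> real) \<Rightarrow> (nat \<Rightarrow> real) \<Rightarrow> bool" where
  "hoh_run trg bnd x0 v0 \<epsilon> ri rd \<tau> a0 N X V P H \<longleftrightarrow>
     X 0 = x0 \<and> V 0 = v0 \<and> P 0 = a0 \<and>
     (\<forall>k<N. norm (grad f (X k)) \<ge> \<epsilon> \<and>
        (\<exists>m. search_stops trg bnd \<tau> rd (X k) (V k) (P k) m \<and>
           (let a = P k * rd ^ m in
              is_step trg bnd (X k) (V k) a (H k) \<and>
              X (Suc k) = hoh_x (X k) (V k) a (H k) \<and>
              V (Suc k) = hoh_v (X k) (V k) a (H k) \<and>
              P (Suc k) = (if m = 0 then a * ri else a))))"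

end

end

theory Submission
  imports Defs
begin

text \<open>The idea is that the Lyapunov function
  \<open>V(x, v) = q * (f x - f xs) + 1/4 * (norm v)^2 + 1/4 * (norm (v + 2 * c * (x - xs)))^2\<close>,
  where \<open>c = sqrt \<mu>\<close> and \<open>q = sqrt (mu_s \<mu> s)\<close>, satisfies \<open>V' + c / 4 * V \<le> b_d ET \<le> b_d ST\<close> along a
  high-order-hold trajectory, so that up to the stepsize, in either trigger, \<open>V\<close> decays at the
  rate \<open>c / 4\<close>. A stepsize exists whenever \<open>C_bd < 0\<close>, because \<open>b_d\<close> starts at \<open>C_bd\<close> and is
  eventually bounded below by a positive constant. Finally \<open>C_bd \<le> - \<kappa> * R^2\<close> for small \<open>a\<close>, where
  \<open>R = norm v + norm (grad f x)\<close>, whereas the linear and quadratic coefficients of \<open>b_d ST\<close> are at most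
  a constant times \<open>R^2\<close>; the factor \<open>R^2\<close> cancels, which makes the lower bound on the stepsize
  independent of the state.\<close>

subsection \<open>Real analysis\<close>

text \<open>The minimizer \<open>xs\<close> enters the Lyapunov function but none of the bounds, so
  it has to be eliminated, and the bound is assembled to do this term by term.
  \<open>A_ET + D_ET\<close> is exactly the change of \<open>lyap_rate\<close> since time 0;
  \<open>B_ET\<close> dominates \<open>c / 4\<close> times the change of \<open>lyap\<close>, where
  cocoercivity removes \<open>xs\<close>; \<open>C_bd\<close> dominates
  \<open>lyap_rate + c / 4 * lyap\<close> at time 0, where strong convexity removes
  \<open>xs\<close>. The obstacle is that the stepsize is a minimum which might not exist, and a
  value of \<open>a\<close> with \<open>C_bd < 0\<close> but without stepsize would be neither
  accepted nor rejected. Positivity of the bound at large times is therefore needed for every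
  \<open>a \<ge> 0\<close>, not only for small \<open>a\<close>. If the sampled gradient
  \<open>gh\<close> is nonzero, the held force drives \<open>v + 2 * c * x\<close> off linearly and
  \<open>lyap\<close> grows quadratically; if it vanishes, the trajectory settles and the constants
  of the bound have to be compared directly.\<close>

lemma norm_square_has_derivative:
  fixes z :: "real \<Rightarrow> 'b::real_inner"
  assumes "(z has_derivative (\<lambda>h. h *\<^sub>R z')) (at t)"
  shows "((\<lambda>t. (norm (z t))\<^sup>2) has_real_derivative 2 * (z t \<bullet> z')) (at t)"
proof -
  have "((\<lambda>t. z t \<bullet> z t) has_derivative (\<lambda>h. z t \<bullet> (h *\<^sub>R z') + (h *\<^sub>R z') \<bullet> z t)) (at t)"
    by (rule has_derivative_inner[OF assms assms])
  also have "(\<lambda>h. z t \<bullet> (h *\<^sub>R z') + (h *\<^sub>R z') \<bullet> z t) = (*) (2 * (z t \<bullet> z'))"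
    by (rule ext) (simp add: inner_commute)
  finally show ?thesis
    by (simp add: has_field_derivative_def power2_norm_eq_inner)
qed

lemma minus_inner_le: "- (y \<bullet> z) \<le> A * B" if "norm y \<le> A" "norm z \<le> B" for y z :: "'a::real_inner"
proof -
  have "- (y \<bullet> z) \<le> norm y * norm z"
    using norm_cauchy_schwarz[of "- y" z] by simp
  also have "\<dots> \<le> A * B"
    using that by (intro mult_mono) (auto intro: order_trans[OF norm_ge_zero])
  finally show ?thesis .
qed

lemma inner_le: "y \<bullet> z \<le> A * B" if "norm y \<le> A" "norm z \<le> B" for y z :: "'a::real_inner"
  using minus_inner_le[of "- y" A z B] that by simp

text \<open>Nothing is assumed about the sign at 0 itself, because the integral of the trigger
  \<open>Perf\<close> vanishes there. Strict negativity just after 0 keeps zeros from accumulating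
  at 0, so the zeros up to \<open>T\<close> form a compact set, nonempty by the intermediate value
  theorem.\<close>

lemma first_positive_zero:
  fixes \<phi> :: "real \<Rightarrow> real"
  assumes cont: "continuous_on {0..T} \<phi>" and "\<eta> > 0" and neg: "\<And>t. 0 < t \<Longrightarrow> t < \<eta> \<Longrightarrow> \<phi> t < 0"
    and "T > 0" "\<phi> T > 0"
  shows "\<exists>\<Delta>>0. \<phi> \<Delta> = 0 \<and> (\<forall>t>0. \<phi> t = 0 \<longrightarrow> \<Delta> \<le> t)"
proof -
  define Z where "Z = {t \<in> {\<eta> / 2..T}. \<phi> t = 0}"
  have T: "\<eta> \<le> T" using neg[of T] assms by force
  have cont': "continuous_on {\<eta> / 2..T} \<phi>"
    using cont assms(2) by (rule_tac continuous_on_subset) auto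
  have "\<phi> (\<eta> / 2) \<le> 0"
    using assms(2) by (intro less_imp_le neg) auto
  then have "\<exists>t\<ge>\<eta> / 2. t \<le> T \<and> \<phi> t = 0"
    using assms T cont' by (intro IVT') auto
  then have "Z \<noteq> {}" by (auto simp: Z_def)
  moreover have "compact Z"
  proof -
    have "Z = {\<eta> / 2..T} \<inter> \<phi> -` {0}" by (auto simp: Z_def)
    then show ?thesis
      using continuous_closed_preimage[OF cont', of "{0}"] bounded_subset[of "{\<eta> / 2..T}" Z]
      by (auto simp: compact_eq_bounded_closed)
  qed
  ultimately obtain \<Delta> where \<Delta>: "\<Delta> \<in> Z" "\<And>t. t \<in> Z \<Longrightarrow> \<Delta> \<le> t"
    using compact_attains_inf by metis
  have "\<Delta> \<le> t" if "t > 0" "\<phi> t = 0" for t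
  proof (cases "t \<le> T")
    case True
    have "\<eta> / 2 \<le> t" using neg[OF that(1)] that assms(2) by force
    then show ?thesis using True that by (intro \<Delta>(2)) (simp add: Z_def)
  next
    case False
    then show ?thesis using \<Delta>(1) by (simp add: Z_def)
  qed
  then show ?thesis using \<Delta>(1) assms(2) by (intro exI[of _ \<Delta>]) (auto simp: Z_def)
qed

lemma weighted_integral_neg:
  fixes h :: "real \<Rightarrow> real"
  assumes "continuous_on {0..t} h" and "t > 0" and "\<And>z. 0 \<le> z \<Longrightarrow> z \<le> t \<Longrightarrow> h z < 0"
  shows "integral {0..t} (\<lambda>z. exp (k * z) * h z) < 0"
proof -
  have cont: "continuous_on {0..t} (\<lambda>z. exp (k * z) * h z)"
    using assms(1) by (intro continuous_intros)
  obtain m where m: "m \<in> {0..t}" "\<And>z. z \<in> {0..t} \<Longrightarrow> exp (k * z) * h z \<le> exp (k * m) * h m"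
    using continuous_attains_sup[OF compact_Icc _ cont] assms(2) by force
  have "integral {0..t} (\<lambda>z. exp (k * z) * h z) \<le> integral {0..t} (\<lambda>z. exp (k * m) * h m)"
    by (intro integral_le integrable_continuous_interval cont continuous_intros m(2))
  also have "\<dots> = t * (exp (k * m) * h m)" using assms(2) by simp
  also have "\<dots> < 0"
    using assms(2) assms(3)[of m] m(1) by (simp add: mult_pos_neg)
  finally show ?thesis .
qed

lemma weighted_integral_eventually_pos:
  fixes h :: "real \<Rightarrow> real"
  assumes cont: "continuous_on {0..} h" and "T > 0" "\<delta> > 0" "k > 0" and "\<And>z. z \<ge> T \<Longrightarrow> h z \<ge> \<delta>"
  shows "\<exists>T'>0. integral {0..T'} (\<lambda>z. exp (k * z) * h z) > 0"
proof -
  define I where "I = integral {0..T} (\<lambda>z. exp (k * z) * h z)"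
  \<comment> \<open>On \<open>{T..T'}\<close> the integrand is at least \<open>\<delta>\<close>,
    which contributes \<open>\<bar>I\<bar> + 1\<close> and outweighs the initial part
    \<open>I\<close>.\<close>
  define T' where "T' = T + (\<bar>I\<bar> + 1) / \<delta>"
  have T': "T \<le> T'" using assms by (simp add: T'_def)
  have int: "(\<lambda>z. exp (k * z) * h z) integrable_on {u..w}" if "u \<ge> 0" for u w
    using that by (intro integrable_continuous_interval continuous_intros continuous_on_subset[OF cont]) auto
  have "integral {T..T'} (\<lambda>z. \<delta>) \<le> integral {T..T'} (\<lambda>z. exp (k * z) * h z)"
  proof (intro integral_le int)
    fix z assume "z \<in> {T..T'}"
    then have "1 * \<delta> \<le> exp (k * z) * h z"
      using assms(2-5) by (intro mult_mono) auto
    then show "\<delta> \<le> exp (k * z) * h z" by simp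
  qed (use assms in auto)
  moreover have "integral {T..T'} (\<lambda>z. \<delta>) = \<bar>I\<bar> + 1"
    using T' assms by (simp add: T'_def)
  moreover have "I + integral {T..T'} (\<lambda>z. exp (k * z) * h z) = integral {0..T'} (\<lambda>z. exp (k * z) * h z)"
    unfolding I_def using T' assms by (intro Henstock_Kurzweil_Integration.integral_combine int) auto
  ultimately have "integral {0..T'} (\<lambda>z. exp (k * z) * h z) > 0" by linarith
  then show ?thesis using T' assms by (intro exI[of _ T']) auto
qed

lemma eventually_quadratic_ge:
  fixes \<alpha> \<beta> \<gamma> :: real
  assumes "\<alpha> > 0"
  shows "eventually (\<lambda>t. \<alpha> * t\<^sup>2 - \<beta> * t - \<gamma> \<ge> 1) at_top"
  using eventually_ge_at_top[of "max 1 ((\<bar>\<beta>\<bar> + \<bar>\<gamma>\<bar> + 1) / \<alpha>)"]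
proof eventually_elim
  case (elim t)
  then have t: "t \<ge> 1" "\<bar>\<beta>\<bar> + \<bar>\<gamma>\<bar> + 1 \<le> \<alpha> * t"
    using assms by (auto simp: field_simps)
  have "(\<bar>\<beta>\<bar> + \<bar>\<gamma>\<bar> + 1) * t \<le> \<alpha> * t * t" using t by (intro mult_right_mono) auto
  moreover have "\<beta> * t \<le> \<bar>\<beta>\<bar> * t" using t by (intro mult_right_mono) auto
  moreover have "\<bar>\<gamma>\<bar> + 1 \<le> (\<bar>\<gamma>\<bar> + 1) * t" using t mult_left_mono[of 1 t "\<bar>\<gamma>\<bar> + 1"] by simp
  ultimately show ?case by (simp add: power2_eq_square algebra_simps)
qed

subsection \<open>Constants\<close>

text \<open>\<open>c\<close> and \<open>q\<close> are parameters rather than definitions, so that rewriting \<open>\<mu>\<close> to \<open>c^2\<close> terminates.\<close>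

locale hoh_params =
  fixes \<mu> L s c q :: real
  assumes mu_pos: "\<mu> > 0" and L_pos: "L > 0" and s_pos: "s > 0"
    and c_def: "c = sqrt \<mu>" and q_def: "q = sqrt (mu_s \<mu> s)"
begin

lemma c_pos: "c > 0" and mu_eq: "\<mu> = c\<^sup>2"
  using mu_pos by (auto simp: c_def)

lemma q_eq: "q = 1 + c * sqrt s"
  using mu_pos s_pos by (simp add: q_def mu_s_def c_def real_sqrt_mult)

lemma q_gt_1: "q > 1"
  using q_eq c_pos s_pos by simp

lemma mu_s_eq: "mu_s \<mu> s = q\<^sup>2"
  by (simp add: q_def mu_s_def)

lemma mu_powr_eq: "\<mu> powr (3/2) = c ^ 3"
proof -
  have "\<mu> powr (3/2) = (\<mu> powr (1/2)) powr 3" by (simp add: powr_powr)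
  also have "\<dots> = c ^ 3"
    using mu_pos c_pos by (simp add: powr_half_sqrt c_def)
  finally show ?thesis .
qed

lemma abs_cq: "\<bar>c\<bar> = c" "\<bar>q\<bar> = q"
  using c_pos q_gt_1 by auto

lemmas to_cq = c_def[symmetric] abs_cq mu_s_eq mu_powr_eq

text \<open>For \<open>a \<le> 1\<close>, this multiple of \<open>norm v + norm (grad f x)\<close>
  dominates the norms of \<open>v\<close>, \<open>grad f x\<close>, the sampled gradient and
  \<open>u\<close> simultaneously.\<close>

definition size_const :: real where
  "size_const = 1 + L + 2 * c + q * (1 + L)"

text \<open>The five lines of summands up to grouping belong to \<open>Al_ST\<close>,
  \<open>Aq_ST\<close>, \<open>Bl_ST\<close>, \<open>Bq_ST\<close> and \<open>D_ST\<close>, in this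
  order: each norm is replaced by one common bound, whose square is factored out. In
  \<open>Bl_ST\<close> the negative term is dropped and \<open>\<bar>a * c - 1 / 2\<bar>\<close> is
  replaced by \<open>c + 1 / 2\<close>.\<close>

definition slope_const :: real where
  "slope_const = (c + L * q / (2 * c) + 3 * q / 2 + q\<^sup>2 / 2 * (L / c + 1))
     + (L * q / (2 * c) + c + L * q\<^sup>2 / (2 * c))
     + c * q / 4 * (q / (2 * c) + 1 / 2 * (1 / c + 1 / q) + (c + 1 / 2))
     + ((10 * c ^ 4 + L\<^sup>2 * q) / (32 * c ^ 3) + q\<^sup>2 * (4 * c ^ 4 + L\<^sup>2 * q) / (32 * c ^ 3)
         + q * (4 * c ^ 4 + L\<^sup>2 * q) / (16 * c ^ 3))
     + (q + c)"

text \<open>The smaller of the two coefficients with which \<open>(norm v)^2\<close> and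
  \<open>(norm (grad f x))^2\<close> are subtracted in \<open>C_bd\<close> at \<open>a = 0\<close>,
  leaving aside the term with \<open>sqrt s\<close>.\<close>

definition decay_const :: real where
  "decay_const = min (13 * c / 16) (3 * c * q / (8 * L))"

text \<open>Chosen so that the terms of \<open>C_bd\<close> caused by \<open>a\<close> cost at most
  a quarter of \<open>decay_const\<close>.\<close>

definition small_a :: real where
  "small_a = min 1 (decay_const / (4 * q * (3 * c + L + c * L)))"

text \<open>Below this time the growth of the self-triggered bound stays under the initial margin
  \<open>decay_const / 4\<close>; the cap 1 allows \<open>t^2\<close> to be replaced by
  \<open>t\<close>.\<close>

definition MIET :: real where
  "MIET = min 1 (decay_const / (4 * (slope_const * size_const\<^sup>2)))"

lemma const_pos: "size_const > 0" "slope_const > 0" "decay_const > 0" "small_a > 0" "MIET > 0"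
proof -
  have q: "q > 0" using q_gt_1 by simp
  show sz: "size_const > 0"
    using c_pos L_pos q by (simp add: size_const_def add_pos_pos)
  show sl: "slope_const > 0"
    unfolding slope_const_def using c_pos L_pos q
    by (intro add_pos_pos mult_pos_pos divide_pos_pos zero_less_power) auto
  show dc: "decay_const > 0"
    using c_pos L_pos q by (simp add: decay_const_def)
  show "small_a > 0"
    using c_pos L_pos q dc by (simp add: small_a_def add_pos_pos)
  show "MIET > 0"
    using sz sl dc by (simp add: MIET_def)
qed

end

subsection \<open>Smooth strongly convex functions\<close>

locale smooth_strongly_convex = hoh_params \<mu> L s c q for \<mu> L s c q +
  fixes f :: "'a::euclidean_space \<Rightarrow> real" and xs :: 'a
  assumes diff: "\<And>x. f differentiable (at x)"
    and strong: "strongly_convex \<mu> f"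
    and lip: "L-lipschitz_on UNIV (grad f)"
    and min: "\<And>y. f xs \<le> f y"
begin

abbreviation G :: "'a \<Rightarrow> 'a" where "G \<equiv> grad f"

lemma has_derivative_f: "(f has_derivative (\<lambda>h. h \<bullet> G x)) (at x)"
  using GDERIV_grad[OF diff, of x] by (simp add: gderiv_def)

lemma continuous_f: "continuous_on S f"
  by (meson has_derivative_f has_derivative_continuous continuous_at_imp_continuous_on)

lemma continuous_G: "continuous_on S G"
  using lipschitz_on_continuous_on[OF lip] continuous_on_subset by blast

lemma strongD: "f y - f x \<ge> G x \<bullet> (y - x) + \<mu> / 2 * (norm (x - y))\<^sup>2"
  using strong by (simp add: strongly_convex_def)

lemma lipD: "norm (G x - G y) \<le> L * norm (x - y)"
  using lipschitz_onD[OF lip, of x y] by (simp add: dist_norm)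

text \<open>Along the segment from \<open>x\<close> to \<open>y\<close>, the difference
  \<open>h\<close> of the two sides has nonpositive derivative by the Lipschitz condition.\<close>

lemma descent: "f y - f x \<le> G x \<bullet> (y - x) + L / 2 * (norm (y - x))\<^sup>2"
proof -
  define d where "d = y - x"
  define h where "h = (\<lambda>t. f (x + t *\<^sub>R d) - t * (G x \<bullet> d) - L / 2 * t\<^sup>2 * (norm d)\<^sup>2)"
  have "(h has_real_derivative ((G (x + t *\<^sub>R d) - G x) \<bullet> d - L * t * (norm d)\<^sup>2)) (at t)" for t
  proof -
    have "((\<lambda>t. f (x + t *\<^sub>R d)) has_derivative (\<lambda>h. (h *\<^sub>R d) \<bullet> G (x + t *\<^sub>R d))) (at t)"
      by (rule has_derivative_compose[OF _ has_derivative_f]) (auto intro!: derivative_eq_intros)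
    then have "((\<lambda>t. f (x + t *\<^sub>R d)) has_real_derivative d \<bullet> G (x + t *\<^sub>R d)) (at t)"
      unfolding has_field_derivative_def by (simp add: mult_commute_abs)
    then show ?thesis
      unfolding h_def by (auto intro!: derivative_eq_intros simp: inner_diff_left inner_diff_right inner_commute)
  qed
  moreover have "(G (x + t *\<^sub>R d) - G x) \<bullet> d - L * t * (norm d)\<^sup>2 \<le> 0" if "t \<ge> 0" for t
  proof -
    have "(G (x + t *\<^sub>R d) - G x) \<bullet> d \<le> norm (G (x + t *\<^sub>R d) - G x) * norm d"
      by (rule norm_cauchy_schwarz)
    also have "\<dots> \<le> (L * norm (t *\<^sub>R d)) * norm d"
      using lipD[of "x + t *\<^sub>R d" x] by (intro mult_right_mono) auto
    finally show ?thesis using that by (simp add: power2_eq_square mult.assoc)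
  qed
  ultimately have "\<forall>t. 0 \<le> t \<and> t \<le> 1 \<longrightarrow> (\<exists>D. (h has_real_derivative D) (at t) \<and> D \<le> 0)"
    by blast
  then have "h 1 \<le> h 0"
    using DERIV_nonpos_imp_nonincreasing[of 0 1 h] by simp
  then show ?thesis by (simp add: h_def d_def)
qed

text \<open>A gradient step of length \<open>1 / L\<close> lowers \<open>f\<close> by at least this
  amount, and cannot fall below the minimum.\<close>

lemma gap_ge: "f x - f xs \<ge> (norm (G x))\<^sup>2 / (2 * L)"
proof -
  have "f (x - (1 / L) *\<^sub>R G x) - f x \<le> - (norm (G x))\<^sup>2 / (2 * L)"
    using descent[of "x - (1 / L) *\<^sub>R G x" x] L_pos
    by (simp add: power2_norm_eq_inner[symmetric] power_divide power2_eq_square field_simps)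
  then show ?thesis using min[of "x - (1 / L) *\<^sub>R G x"] by simp
qed

lemma G_xs: "G xs = 0"
  using gap_ge[of xs] L_pos by (simp add: divide_le_0_iff)

text \<open>The value at \<open>z\<close>, a step from the minimizer along \<open>G y\<close>, is
  bounded above by smoothness at \<open>xs\<close> and below by convexity at \<open>y\<close>;
  comparing the two and adding \<open>gap_ge\<close> gives the claim.\<close>

lemma cocoercive: "G y \<bullet> (y - xs) \<ge> (norm (G y))\<^sup>2 / L"
proof -
  define z where "z = xs + (1 / L) *\<^sub>R G y"
  have "f z - f xs \<le> (norm (G y))\<^sup>2 / (2 * L)"
    using descent[of z xs] L_pos by (simp add: z_def G_xs power_divide power2_eq_square field_simps)
  moreover have "f z - f y \<ge> G y \<bullet> (z - y)"
    using strongD[where x=y and y=z] mu_pos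
    by (smt (verit) divide_pos_pos mult_nonneg_nonneg zero_le_power2)
  moreover have "G y \<bullet> (z - y) = (norm (G y))\<^sup>2 / L - G y \<bullet> (y - xs)"
    by (simp add: z_def inner_simps power2_norm_eq_inner)
  moreover have "(norm (G y))\<^sup>2 / L = (norm (G y))\<^sup>2 / (2 * L) + (norm (G y))\<^sup>2 / (2 * L)"
    using L_pos by (simp add: field_simps)
  ultimately show ?thesis using gap_ge[of y] by linarith
qed

lemma G_le: "norm (G x) \<le> L * norm (x - xs)"
  using lipD[of x xs] by (simp add: G_xs)

text \<open>Strong convexity applied in both directions between \<open>x\<close> and
  \<open>xs\<close>, then added.\<close>

lemma G_ge: "\<mu> * norm (x - xs) \<le> norm (G x)"
proof -
  have "f xs - f x \<ge> G x \<bullet> (xs - x) + \<mu> / 2 * (norm (x - xs))\<^sup>2" by (rule strongD)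
  moreover have "f x - f xs \<ge> \<mu> / 2 * (norm (x - xs))\<^sup>2"
    using strongD[where x=xs and y=x] by (simp add: G_xs norm_minus_commute)
  moreover have "G x \<bullet> (x - xs) \<le> norm (G x) * norm (x - xs)" by (rule norm_cauchy_schwarz)
  moreover have "G x \<bullet> (xs - x) = - (G x \<bullet> (x - xs))"
    by (simp add: inner_diff_right)
  moreover have "\<mu> / 2 * (norm (x - xs))\<^sup>2 + \<mu> / 2 * (norm (x - xs))\<^sup>2 = \<mu> * norm (x - xs) * norm (x - xs)"
    by (simp add: power2_eq_square)
  ultimately have "\<mu> * norm (x - xs) * norm (x - xs) \<le> norm (G x) * norm (x - xs)"
    by linarith
  then show ?thesis by (cases "x = xs") (auto simp: G_xs)
qed

lemma mu_le_L: "\<mu> \<le> L"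
proof -
  obtain b :: 'a where "b \<in> Basis" using nonempty_Basis by blast
  then show ?thesis using G_le[of "xs + b"] G_ge[of "xs + b"] by simp
qed

subsection \<open>Trajectories and the Lyapunov function\<close>

definition gh :: "'a \<Rightarrow> 'a \<Rightarrow> real \<Rightarrow> 'a" where
  "gh x v a = G (x + a *\<^sub>R v)"

text \<open>The negative of the initial acceleration; its norm is the quantity
  \<open>W_ST\<close>.\<close>

definition u :: "'a \<Rightarrow> 'a \<Rightarrow> real \<Rightarrow> 'a" where
  "u x v a = (2 * c) *\<^sub>R v + q *\<^sub>R gh x v a"

abbreviation "X \<equiv> hoh_x \<mu> s f"
abbreviation "V \<equiv> hoh_v \<mu> s f"

lemma hoh_v_diff: "V x v a t - v = - ((1 - exp (- 2 * c * t)) / (2 * c)) *\<^sub>R u x v a"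
proof -
  have "V x v a t - v = (exp (- 2 * c * t) - 1) *\<^sub>R v
      + ((exp (- 2 * c * t) - 1) * q / (2 * c)) *\<^sub>R gh x v a"
    by (simp add: hoh_v_def to_cq Let_def gh_def scaleR_diff_left)
  then show ?thesis
    using c_pos by (simp add: u_def scaleR_add_right scaleR_diff_left diff_divide_distrib left_diff_distrib)
qed

lemma hoh_x_diff: "X x v a t - x = - (q * t / (2 * c)) *\<^sub>R gh x v a
    + ((1 - exp (- 2 * c * t)) / (4 * c\<^sup>2)) *\<^sub>R u x v a"
  by (simp add: hoh_x_def to_cq gh_def u_def Let_def) (simp add: mu_eq Let_def)

text \<open>The damping cancels in \<open>v + 2 * c * x\<close>, whose derivative is the constant
  \<open>- q * gh\<close>. Hence the last square of the Lyapunov function is an exact quadratic in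
  \<open>t\<close>.\<close>

lemma hoh_drift: "V x v a t - v + (2 * c) *\<^sub>R (X x v a t - x) = - (q * t) *\<^sub>R gh x v a"
proof -
  have "2 * c * ((1 - exp (- 2 * c * t)) / (4 * c\<^sup>2)) = (1 - exp (- 2 * c * t)) / (2 * c)"
    using c_pos by (simp add: field_simps power2_eq_square)
  moreover have "2 * c * (q * t / (2 * c)) = q * t"
    using c_pos by simp
  ultimately show ?thesis
    unfolding hoh_v_diff hoh_x_diff scaleR_add_right scaleR_scaleR by simp
qed

text \<open>The linear bound serves the self-triggered estimates, the constant bound the behaviour
  at large times.\<close>

lemma contraction_bounds:
  assumes "t \<ge> 0"
  shows "0 \<le> 1 - exp (- 2 * c * t)" "1 - exp (- 2 * c * t) \<le> 2 * c * t" "1 - exp (- 2 * c * t) \<le> 1"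
  using assms c_pos exp_ge_add_one_self[of "- 2 * c * t"] by auto

lemma norm_hoh_v_diff:
  assumes "t \<ge> 0"
  shows "norm (V x v a t - v) \<le> t * norm (u x v a)"
    and "norm (V x v a t - v) \<le> norm (u x v a) / (2 * c)"
proof -
  have *: "norm (V x v a t - v) = (1 - exp (- 2 * c * t)) / (2 * c) * norm (u x v a)"
    unfolding hoh_v_diff using contraction_bounds(1)[OF assms] c_pos by simp
  show "norm (V x v a t - v) \<le> t * norm (u x v a)"
    unfolding * using contraction_bounds(2)[OF assms] c_pos
    by (intro mult_right_mono) (auto simp: field_simps)
  show "norm (V x v a t - v) \<le> norm (u x v a) / (2 * c)"
    unfolding * using mult_right_mono[OF contraction_bounds(3)[OF assms], of "norm (u x v a)"] c_pos
    by (simp add: field_simps)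
qed

lemma norm_hoh_x_diff:
  assumes "t \<ge> 0"
  shows "norm (X x v a t - x) \<le> t * ((q * norm (gh x v a) + norm (u x v a)) / (2 * c))"
    and "norm (X x v a t - x) \<le> q * norm (gh x v a) / (2 * c) * t + norm (u x v a) / (4 * c\<^sup>2)"
proof -
  have *: "norm (X x v a t - x) \<le> q * t / (2 * c) * norm (gh x v a)
      + (1 - exp (- 2 * c * t)) / (4 * c\<^sup>2) * norm (u x v a)"
    unfolding hoh_x_diff
    using contraction_bounds(1)[OF assms] c_pos q_gt_1 assms norm_triangle_ineq[of "- (q * t / (2 * c)) *\<^sub>R gh x v a"
      "((1 - exp (- 2 * c * t)) / (4 * c\<^sup>2)) *\<^sub>R u x v a"] by (simp add: abs_mult)
  have "(1 - exp (- 2 * c * t)) / (4 * c\<^sup>2) * norm (u x v a) \<le> (2 * c * t) / (4 * c\<^sup>2) * norm (u x v a)"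
    by (intro mult_right_mono divide_right_mono contraction_bounds(2)[OF assms]) auto
  moreover have "(2 * c * t) / (4 * c\<^sup>2) = t / (2 * c)"
    using c_pos by (simp add: field_simps power2_eq_square)
  ultimately have "norm (X x v a t - x) \<le> q * t / (2 * c) * norm (gh x v a) + t / (2 * c) * norm (u x v a)"
    using * by simp
  then show "norm (X x v a t - x) \<le> t * ((q * norm (gh x v a) + norm (u x v a)) / (2 * c))"
    by (simp add: add_divide_distrib algebra_simps)
  have "(1 - exp (- 2 * c * t)) / (4 * c\<^sup>2) * norm (u x v a) \<le> 1 / (4 * c\<^sup>2) * norm (u x v a)"
    by (intro mult_right_mono divide_right_mono contraction_bounds(3)[OF assms]) auto
  then have "(1 - exp (- 2 * c * t)) / (4 * c\<^sup>2) * norm (u x v a) \<le> norm (u x v a) / (4 * c\<^sup>2)"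
    by simp
  moreover have "q * t / (2 * c) * norm (gh x v a) = q * norm (gh x v a) / (2 * c) * t"
    by simp
  ultimately show "norm (X x v a t - x) \<le> q * norm (gh x v a) / (2 * c) * t + norm (u x v a) / (4 * c\<^sup>2)"
    using * by linarith
qed

definition lyap :: "'a \<Rightarrow> 'a \<Rightarrow> real" where
  "lyap x v = q * (f x - f xs) + 1 / 4 * (norm v)\<^sup>2 + 1 / 4 * (norm (v + (2 * c) *\<^sub>R (x - xs)))\<^sup>2"

text \<open>The derivative of \<open>lyap\<close> along \<open>x' = v\<close>,
  \<open>v' = - 2 * c * v - q * g\<close> with \<open>g\<close> held fixed. The terms in
  \<open>G x\<close> and \<open>g\<close> do not cancel, because the force is frozen while
  \<open>x\<close> moves.\<close>

definition lyap_rate :: "'a \<Rightarrow> 'a \<Rightarrow> 'a \<Rightarrow> real" where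
  "lyap_rate g x v = q * (G x \<bullet> v) - c * (norm v)\<^sup>2 - q * (v \<bullet> g) - c * q * ((x - xs) \<bullet> g)"

lemma lyap_has_derivative:
  "((\<lambda>t. lyap (X x v a t) (V x v a t)) has_real_derivative
     lyap_rate (gh x v a) (X x v a t) (V x v a t)) (at t)"
proof -
  define g where "g = gh x v a"
  define x' v' where "x' = X x v a t" and "v' = V x v a t"
  define z where "z = (\<lambda>t. V x v a t + (2 * c) *\<^sub>R (X x v a t - xs))"
  have dX: "(X x v a has_derivative (\<lambda>h. h *\<^sub>R v')) (at t)"
    using hoh_ode(1)[OF mu_pos, of s f x v a t] by (simp add: has_vector_derivative_def v'_def)
  have dV: "(V x v a has_derivative (\<lambda>h. h *\<^sub>R (- (2 * c) *\<^sub>R v' - q *\<^sub>R g))) (at t)"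
    using hoh_ode(2)[OF mu_pos, of s f x v a t]
    by (simp add: has_vector_derivative_def v'_def g_def gh_def to_cq)
  have dz: "(z has_derivative (\<lambda>h. h *\<^sub>R (- q *\<^sub>R g))) (at t)"
    unfolding z_def by (rule derivative_eq_intros dX dV refl)+ (simp add: algebra_simps)
  have "((\<lambda>t. f (X x v a t)) has_derivative (\<lambda>h. (h *\<^sub>R v') \<bullet> G x')) (at t)"
    using has_derivative_compose[OF dX has_derivative_f] by (simp add: x'_def)
  then have df: "((\<lambda>t. f (X x v a t)) has_real_derivative v' \<bullet> G x') (at t)"
    unfolding has_field_derivative_def by (simp add: mult_commute_abs)
  have "((\<lambda>t. lyap (X x v a t) (V x v a t)) has_real_derivative
      q * (v' \<bullet> G x' - 0) + 1 / 4 * (2 * (v' \<bullet> (- (2 * c) *\<^sub>R v' - q *\<^sub>R g)))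
        + 1 / 4 * (2 * (z t \<bullet> (- q *\<^sub>R g)))) (at t)"
    using DERIV_add[OF DERIV_add[OF DERIV_cmult[OF DERIV_diff[OF df DERIV_const[of "f xs"]], of q]
        DERIV_cmult[OF norm_square_has_derivative[OF dV], of "1 / 4"]]
        DERIV_cmult[OF norm_square_has_derivative[OF dz], of "1 / 4"]]
    unfolding lyap_def z_def v'_def .
  moreover have "q * (v' \<bullet> G x' - 0) + 1 / 4 * (2 * (v' \<bullet> (- (2 * c) *\<^sub>R v' - q *\<^sub>R g)))
        + 1 / 4 * (2 * (z t \<bullet> (- q *\<^sub>R g))) = lyap_rate g x' v'"
    unfolding lyap_rate_def z_def x'_def[symmetric] v'_def[symmetric] power2_norm_eq_inner
      inner_simps inner_commute[of v' "G x'"]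
    by (simp add: algebra_simps)
  ultimately show ?thesis
    by (simp add: g_def x'_def v'_def)
qed

subsection \<open>The event-triggered bound\<close>

abbreviation "bd \<equiv> b_d \<mu> L s f"

lemma A_ET_eq: "A_ET \<mu> s f x v a t =
    q * ((G (X x v a t) - G x) \<bullet> V x v a t - (V x v a t - v) \<bullet> gh x v a
      - c * ((X x v a t - x) \<bullet> gh x v a))
    - c * ((V x v a t - v) \<bullet> V x v a t)"
  by (simp add: A_ET_def Let_def to_cq gh_def)

lemma B_ET_eq: "B_ET \<mu> L s f x v a t =
    c / 4 * (q * (f (X x v a t) - f x) - c * q * t * ((norm (gh x v a))\<^sup>2 / L)
      + c * q * t * (gh x v a \<bullet> (a *\<^sub>R v))
      + 1 / 4 * ((norm (V x v a t))\<^sup>2 - (norm v)\<^sup>2)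
      + 1 / 4 * (norm ((q * t) *\<^sub>R gh x v a))\<^sup>2 - 1 / 2 * (q * t) * (gh x v a \<bullet> v))"
  by (simp only: B_ET_def Let_def to_cq q_def[symmetric] hoh_drift gh_def[symmetric]) (simp add: abs_cq)

lemma C_bd_eq: "C_bd \<mu> L s f x v a =
    - (13 * c / 16) * (norm v)\<^sup>2 - c ^ 4 * sqrt s / 2 * ((norm (G x))\<^sup>2 / L\<^sup>2)
    + q * (- (3 * c / 8) * ((norm (G x))\<^sup>2 / L) + c * (f x - f (x + a *\<^sub>R v))
       + c * norm (G x) * norm (a *\<^sub>R v) - c ^ 3 / 2 * (norm (a *\<^sub>R v))\<^sup>2
       - (gh x v a - G x) \<bullet> v + c * (gh x v a \<bullet> (a *\<^sub>R v)))"
proof -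
  have "\<mu>\<^sup>2 = c ^ 4" by (simp add: mu_eq)
  then show ?thesis
    by (simp add: C_bd_def Let_def to_cq gh_def)
qed

lemma D_ET_eq: "D_ET \<mu> s f x v a t =
    q * (G x \<bullet> (V x v a t - v)) - c * (v \<bullet> (V x v a t - v))"
  by (simp add: D_ET_def Let_def to_cq)

lemma initial_rate_le:
  "lyap_rate (gh x v a) x v + c / 4 * lyap x v \<le> C_bd \<mu> L s f x v a"
proof -
  define g y where "g = gh x v a" and "y = x + a *\<^sub>R v"
  define n p r where "n = norm (x - xs)" and "p = norm (a *\<^sub>R v)" and "r = norm (G x)"
  define Z where "Z = (norm (v + (2 * c) *\<^sub>R (x - xs)))\<^sup>2"
  define K where "K = c * q * (c\<^sup>2 / 2)"
  have cq: "0 \<le> c" "0 \<le> c * q" "0 \<le> c * q * (c\<^sup>2 / 2)" "0 \<le> c ^ 4 * sqrt s / 2"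
    using c_pos q_gt_1 s_pos by auto
  have "f xs - f y \<ge> - (g \<bullet> (x - xs) + g \<bullet> (a *\<^sub>R v)) + c\<^sup>2 / 2 * (norm (y - xs))\<^sup>2"
    using strongD[where x=y and y=xs]
    by (simp add: g_def gh_def y_def inner_simps mu_eq[symmetric])
  from mult_left_mono[OF this cq(2)]
  have T1: "- (c * q * (g \<bullet> (x - xs))) - c * q * (g \<bullet> (a *\<^sub>R v)) + K * (norm (y - xs))\<^sup>2
      \<le> c * q * (f xs - f y)"
    by (simp add: K_def algebra_simps)
  \<comment> \<open>The reverse triangle inequality leaves a cross term \<open>n * p\<close>;
    \<open>G_ge\<close> turns its factor \<open>n\<close> into \<open>r\<close>, which is where the
    term \<open>norm (grad f x) * norm (a *\<^sub>R v)\<close> of \<open>C_bd\<close> comes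
    from.\<close>
  have "(norm (y - xs))\<^sup>2 \<ge> n\<^sup>2 + p\<^sup>2 - 2 * n * p"
  proof -
    have "(n - p)\<^sup>2 = \<bar>n - p\<bar>\<^sup>2" by simp
    also have "\<dots> \<le> (norm (y - xs))\<^sup>2"
      using norm_triangle_ineq3[of "x - xs" "- (a *\<^sub>R v)"]
      by (intro power_mono) (auto simp: n_def p_def y_def algebra_simps)
    finally show ?thesis by (simp add: power2_diff)
  qed
  from mult_left_mono[OF this cq(3)]
  have T2: "K * n\<^sup>2 + K * p\<^sup>2 - 2 * (K * n * p) \<le> K * (norm (y - xs))\<^sup>2"
    by (simp add: K_def algebra_simps)
  have "c\<^sup>2 * n \<le> r"
    using G_ge[of x] by (simp add: n_def r_def mu_eq[symmetric])
  then have "c * q * p * (c\<^sup>2 * n) \<le> c * q * p * r"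
    using cq by (intro mult_left_mono) (auto simp: p_def)
  then have T3: "2 * (K * n * p) \<le> c * q * p * r"
    by (simp add: K_def algebra_simps)
  have "Z \<le> 2 * (norm v)\<^sup>2 + 8 * c\<^sup>2 * n\<^sup>2"
  proof -
    have "Z \<le> (norm v + 2 * c * n)\<^sup>2"
      unfolding Z_def using norm_triangle_ineq[of v "(2 * c) *\<^sub>R (x - xs)"] cq
      by (intro power_mono) (auto simp: n_def)
    also have "\<dots> \<le> 2 * (norm v)\<^sup>2 + 8 * c\<^sup>2 * n\<^sup>2"
      using zero_le_power2[of "norm v - 2 * c * n"] by (simp add: power2_eq_square algebra_simps)
    finally show ?thesis .
  qed
  from mult_left_mono[OF this cq(1)]
  have T4: "c * Z \<le> 2 * (c * (norm v)\<^sup>2) + 8 * (c ^ 3 * n\<^sup>2)"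
    by (simp add: algebra_simps power3_eq_cube power2_eq_square)
  have "f x - f xs \<ge> (r\<^sup>2 / L) / 2"
    using gap_ge[of x] by (simp add: r_def mult.commute)
  from mult_left_mono[OF this cq(2)]
  have T5: "c * q * (r\<^sup>2 / L) / 2 \<le> c * q * (f x - f xs)"
    by simp
  have "r\<^sup>2 \<le> (L * n)\<^sup>2"
    using G_le[of x] by (intro power_mono) (auto simp: r_def n_def)
  then have "r\<^sup>2 / L\<^sup>2 \<le> n\<^sup>2"
    using L_pos by (simp add: field_simps power_mult_distrib)
  from mult_left_mono[OF this cq(4)]
  have T6: "c ^ 4 * sqrt s / 2 * (r\<^sup>2 / L\<^sup>2) \<le> c ^ 4 * sqrt s / 2 * n\<^sup>2" .
  \<comment> \<open>Here \<open>q = 1 + c * sqrt s\<close> matters: after paying the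
    \<open>c ^ 3 * n^2 / 2\<close> caused by the last square of \<open>lyap\<close>, exactly the
    part with \<open>sqrt s\<close> of the quadratic gain survives.\<close>
  have E: "c ^ 4 * sqrt s / 2 * n\<^sup>2 = K * n\<^sup>2 - c ^ 3 * n\<^sup>2 / 2"
    by (simp add: K_def q_eq power4_eq_xxxx power3_eq_cube power2_eq_square algebra_simps)
  have L: "lyap_rate g x v + c / 4 * lyap x v = q * (G x \<bullet> v) - c * (norm v)\<^sup>2 - q * (v \<bullet> g)
      - c * q * (g \<bullet> (x - xs)) + c * q * (f x - f xs) / 4 + c * (norm v)\<^sup>2 / 16 + c * Z / 16"
    by (simp add: lyap_rate_def lyap_def Z_def inner_commute field_simps)
  have R: "C_bd \<mu> L s f x v a = - 13 / 16 * (c * (norm v)\<^sup>2) - c ^ 4 * sqrt s / 2 * (r\<^sup>2 / L\<^sup>2)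
      - 3 / 8 * (c * q * (r\<^sup>2 / L)) + c * q * (f x - f y) + c * q * p * r - K * p\<^sup>2
      - q * (v \<bullet> g) + q * (G x \<bullet> v) + c * q * (g \<bullet> (a *\<^sub>R v))"
    unfolding C_bd_eq r_def[symmetric] p_def[symmetric] g_def[symmetric] y_def[symmetric] K_def
    by (simp add: inner_diff_left inner_commute[of v] algebra_simps power3_eq_cube power2_eq_square)
  \<comment> \<open>With every product replaced by a variable, only the rational coefficients remain
    to be compared.\<close>
  have linear: "Gv - cN - vg - i1 + d0 / 4 + cN / 16 + cZ / 16
      \<le> - 13 / 16 * cN - R2 - 3 / 8 * R1 + (d0 + d1) + pr - Kp - vg + Gv + i2"
    if "- i1 - i2 + Y \<le> d1" "Kn + Kp - 2 * Knp \<le> Y" "2 * Knp \<le> pr" "cZ \<le> 2 * cN + 8 * n3"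
      "R1 / 2 \<le> d0" "R2 \<le> R3" "R3 = Kn - n3 / 2"
    for Gv cN vg i1 i2 d0 d1 cZ R1 R2 R3 pr Kn Kp Knp Y n3 :: real
    using that by linarith
  have F: "c * q * (f x - f y) = c * q * (f x - f xs) + c * q * (f xs - f y)"
    by (simp add: algebra_simps)
  show ?thesis
    unfolding g_def[symmetric] L R F by (rule linear[OF T1 T2 T3 T4 T5 T6 E])
qed

text \<open>\<open>D_ET\<close> supplies the cross terms that turn the products of
  \<open>A_ET\<close> with differences into differences of products, so nothing is lost
  here.\<close>

lemma AD_ET_eq: "A_ET \<mu> s f x v a t + D_ET \<mu> s f x v a t
   = lyap_rate (gh x v a) (X x v a t) (V x v a t) - lyap_rate (gh x v a) x v"
proof -
  define g x' v' where "g = gh x v a" and "x' = X x v a t" and "v' = V x v a t"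
  have "(v' - v) \<bullet> v' = v' \<bullet> v' - v' \<bullet> v" "v \<bullet> (v' - v) = v' \<bullet> v - v \<bullet> v"
    by (simp_all add: inner_diff_left inner_diff_right inner_commute)
  moreover have "(x' - xs) \<bullet> g = (x' - x) \<bullet> g + (x - xs) \<bullet> g"
    by (simp add: inner_diff_left)
  ultimately show ?thesis
    unfolding A_ET_eq D_ET_eq lyap_rate_def g_def[symmetric] x'_def[symmetric] v'_def[symmetric]
      power2_norm_eq_inner inner_diff_left[of "G _" "G _"] inner_diff_left[of v' v] inner_diff_right[of "G x"]
    by (simp add: algebra_simps)
qed

text \<open>The exact change contains \<open>- c * q * t\<close> times the inner product of
  \<open>g\<close> with \<open>x - xs\<close>. Cocoercivity at \<open>x + a *\<^sub>R v\<close>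
  bounds it by the two terms of \<open>B_ET\<close> with \<open>(norm g)^2 / L\<close> and
  \<open>a *\<^sub>R v\<close>; everything else agrees.\<close>

lemma B_ET_ge:
  assumes "t \<ge> 0"
  shows "c / 4 * (lyap (X x v a t) (V x v a t) - lyap x v) \<le> B_ET \<mu> L s f x v a t"
proof -
  define g z where "g = gh x v a" and "z = v + (2 * c) *\<^sub>R (x - xs)"
  have "V x v a t + (2 * c) *\<^sub>R (X x v a t - xs) = z - (q * t) *\<^sub>R g"
    using hoh_drift[of x v a t] by (simp add: z_def g_def algebra_simps)
  then have "(norm (V x v a t + (2 * c) *\<^sub>R (X x v a t - xs)))\<^sup>2
      = (norm z)\<^sup>2 - 2 * (q * t) * (g \<bullet> z) + (norm ((q * t) *\<^sub>R g))\<^sup>2"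
    by (simp only: power2_norm_eq_inner) (simp add: inner_simps inner_commute)
  moreover have "g \<bullet> z = g \<bullet> v + 2 * c * (g \<bullet> (x - xs))"
    by (simp add: z_def inner_add_right)
  moreover have "c * (q * t) * ((norm g)\<^sup>2 / L) \<le> c * (q * t) * (g \<bullet> (x - xs) + g \<bullet> (a *\<^sub>R v))"
    using cocoercive[of "x + a *\<^sub>R v"] assms c_pos q_gt_1
    by (intro mult_left_mono) (auto simp: g_def gh_def inner_simps)
  ultimately have "lyap (X x v a t) (V x v a t) - lyap x v \<le> q * (f (X x v a t) - f x) - c * q * t * ((norm g)\<^sup>2 / L)
      + c * q * t * (g \<bullet> (a *\<^sub>R v))
      + 1 / 4 * ((norm (V x v a t))\<^sup>2 - (norm v)\<^sup>2)
      + 1 / 4 * (norm ((q * t) *\<^sub>R g))\<^sup>2 - 1 / 2 * (q * t) * (g \<bullet> v)"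
    unfolding lyap_def z_def[symmetric] by (simp add: algebra_simps)
  then show ?thesis
    unfolding B_ET_eq g_def[symmetric] using c_pos by (intro mult_left_mono) auto
qed

lemma lyap_rate_le_ET:
  assumes "t \<ge> 0"
  shows "lyap_rate (gh x v a) (X x v a t) (V x v a t) + c / 4 * lyap (X x v a t) (V x v a t) \<le> bd ET x v a t"
  using initial_rate_le[of x v a] AD_ET_eq[of x v a t] B_ET_ge[OF assms, of x v a]
  by (simp add: right_diff_distrib)

subsection \<open>The self-triggered bound\<close>

lemma W_ST_eq: "W_ST \<mu> s f x v a = norm (u x v a)"
  by (simp add: W_ST_def to_cq q_def[symmetric] u_def gh_def)

lemma Al_ST_eq: "Al_ST \<mu> L s f x v a =
    norm (u x v a) * (c * norm v + L * q / (2 * c) * norm v + 3 * q / 2 * norm (gh x v a))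
    + q\<^sup>2 / 2 * norm (gh x v a) * (L / c * norm v + norm (gh x v a))"
  by (simp add: Al_ST_def Let_def W_ST_eq to_cq gh_def)

lemma Aq_ST_eq: "Aq_ST \<mu> L s f x v a =
    norm (u x v a) * ((L * q / (2 * c) + c) * norm (u x v a) + L * q\<^sup>2 / (2 * c) * norm (gh x v a))"
  by (simp add: Aq_ST_def Let_def W_ST_eq to_cq gh_def)

lemma Bl_ST_eq: "Bl_ST \<mu> L s f x v a =
    c * q / 4 * (q / (2 * c) * norm (gh x v a) * norm (G x)
      + 1 / 2 * norm (u x v a) * (norm (G x) / c + norm v / q)
      - c * ((norm (gh x v a))\<^sup>2 / L) + (a * c - 1 / 2) * (gh x v a \<bullet> v))"
  by (simp add: Bl_ST_def Let_def W_ST_eq to_cq gh_def)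

lemma Bq_ST_eq: "Bq_ST \<mu> L s f x v a =
    (10 * c ^ 4 + L\<^sup>2 * q) / (32 * c ^ 3) * (norm (u x v a))\<^sup>2
     + q\<^sup>2 * (4 * c ^ 4 + L\<^sup>2 * q) / (32 * c ^ 3) * (norm (gh x v a))\<^sup>2
     + q * (4 * c ^ 4 + L\<^sup>2 * q) / (16 * c ^ 3) * norm (u x v a) * norm (gh x v a)"
proof -
  have "\<mu>\<^sup>2 = c ^ 4" by (simp add: mu_eq)
  then show ?thesis by (simp add: Bq_ST_def Let_def W_ST_eq to_cq gh_def)
qed

lemma D_ST_eq: "D_ST \<mu> s f x v a = norm (u x v a) * (q * norm (G x) + c * norm v)"
  by (simp add: D_ST_def W_ST_eq to_cq)

lemma norm_hoh_v_le: "norm (V x v a t) \<le> norm v + t * norm (u x v a)" if "t \<ge> 0"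
  using norm_triangle_ineq[of v "V x v a t - v"] norm_hoh_v_diff(1)[OF that, of x v a] by simp

text \<open>Each inner product is estimated by Cauchy-Schwarz with displacements linear in
  \<open>t\<close>; the resulting quadratic has exactly the coefficients \<open>Aq_ST\<close> and
  \<open>Al_ST\<close>.\<close>

lemma A_ET_le_ST:
  assumes "t \<ge> 0"
  shows "A_ET \<mu> s f x v a t \<le> Aq_ST \<mu> L s f x v a * t\<^sup>2 + Al_ST \<mu> L s f x v a * t"
proof -
  define g W n \<delta> where "g = norm (gh x v a)" and "W = norm (u x v a)" and "n = norm v"
    and "\<delta> = t * ((q * g + W) / (2 * c))"
  have \<delta>: "norm (X x v a t - x) \<le> \<delta>"
    using norm_hoh_x_diff(1)[OF assms, of x v a] by (simp add: \<delta>_def g_def W_def)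
  have V: "norm (V x v a t) \<le> n + t * W"
    using norm_hoh_v_le[OF assms, of x v a] by (simp add: n_def W_def)
  have Vd: "norm (V x v a t - v) \<le> t * W"
    using norm_hoh_v_diff(1)[OF assms, of x v a] by (simp add: W_def)
  have "norm (G (X x v a t) - G x) \<le> L * \<delta>"
    using \<delta> L_pos by (intro order_trans[OF lipD] mult_left_mono) auto
  from inner_le[OF this V]
  have p1: "(G (X x v a t) - G x) \<bullet> V x v a t \<le> L * \<delta> * (n + t * W)" .
  have p2: "- ((V x v a t - v) \<bullet> gh x v a) \<le> t * W * g"
    using Vd by (rule minus_inner_le) (simp add: g_def)
  have "- ((X x v a t - x) \<bullet> gh x v a) \<le> \<delta> * g"
    using \<delta> by (rule minus_inner_le) (simp add: g_def)
  then have p3: "- (c * ((X x v a t - x) \<bullet> gh x v a)) \<le> c * (\<delta> * g)"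
    using c_pos mult_left_mono[of "- ((X x v a t - x) \<bullet> gh x v a)" "\<delta> * g" c] by simp
  have p4: "- (c * ((V x v a t - v) \<bullet> V x v a t)) \<le> c * (t * W * (n + t * W))"
    using c_pos mult_left_mono[OF minus_inner_le[OF Vd V], of c] by simp
  have "q * ((G (X x v a t) - G x) \<bullet> V x v a t - (V x v a t - v) \<bullet> gh x v a
      - c * ((X x v a t - x) \<bullet> gh x v a)) \<le> q * (L * \<delta> * (n + t * W) + t * W * g + c * (\<delta> * g))"
    using p1 p2 p3 q_gt_1 by (intro mult_left_mono) auto
  then have "A_ET \<mu> s f x v a t \<le> q * (L * \<delta> * (n + t * W) + t * W * g + c * (\<delta> * g))
      + c * (t * W * (n + t * W))"
    unfolding A_ET_eq using p4 by linarith
  also have "\<dots> = (W * ((L * q / (2 * c) + c) * W + L * q\<^sup>2 / (2 * c) * g)) * t\<^sup>2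
      + (W * (c * n + L * q / (2 * c) * n + 3 * q / 2 * g) + q\<^sup>2 / 2 * g * (L / c * n + g)) * t"
    using c_pos by (simp add: \<delta>_def field_simps power2_eq_square)
  finally show ?thesis
    unfolding Al_ST_eq Aq_ST_eq g_def[symmetric] W_def[symmetric] n_def[symmetric] .
qed

text \<open>The left side is the coefficient of \<open>t^2\<close> that the estimate of
  \<open>B_ET\<close> produces. \<open>Bq_ST\<close> exceeds it: \<open>L * c^2\<close> becomes
  \<open>L^2\<close>, which is where \<open>\<mu> \<le> L\<close> is used, and the remaining
  coefficients are enlarged.\<close>

lemma Bq_ST_ge:
  "c / 4 * (q * (L / 2 * ((q * norm (gh x v a) + norm (u x v a)) / (2 * c))\<^sup>2)
     + 1 / 4 * (norm (u x v a))\<^sup>2 + 1 / 4 * (q * norm (gh x v a))\<^sup>2) \<le> Bq_ST \<mu> L s f x v a"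
proof -
  define g W where "g = norm (gh x v a)" and "W = norm (u x v a)"
  have gW: "g \<ge> 0" "W \<ge> 0" by (auto simp: g_def W_def)
  have "L * c\<^sup>2 \<le> L * L"
    using mu_le_L L_pos by (intro mult_left_mono) (auto simp: mu_eq[symmetric])
  then have "L * c\<^sup>2 * (q * (q * g + W)\<^sup>2) \<le> L\<^sup>2 * (q * (q * g + W)\<^sup>2)"
    using q_gt_1 by (intro mult_right_mono) (auto simp: power2_eq_square)
  moreover have "0 \<le> 8 * c ^ 4 * W\<^sup>2 + 2 * c ^ 4 * q\<^sup>2 * g\<^sup>2 + 8 * c ^ 4 * q * (W * g)"
    using gW c_pos q_gt_1 by (intro add_nonneg_nonneg mult_nonneg_nonneg) auto
  ultimately have "L * c\<^sup>2 * (q * (q * g + W)\<^sup>2) + 2 * c ^ 4 * W\<^sup>2 + 2 * c ^ 4 * q\<^sup>2 * g\<^sup>2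
      \<le> L\<^sup>2 * (q * (q * g + W)\<^sup>2) + 10 * c ^ 4 * W\<^sup>2 + 4 * c ^ 4 * q\<^sup>2 * g\<^sup>2 + 8 * c ^ 4 * q * (W * g)"
    by linarith
  from divide_right_mono[OF this, of "32 * c ^ 3"]
  have "(L * c\<^sup>2 * (q * (q * g + W)\<^sup>2) + 2 * c ^ 4 * W\<^sup>2 + 2 * c ^ 4 * q\<^sup>2 * g\<^sup>2) / (32 * c ^ 3)
      \<le> (L\<^sup>2 * (q * (q * g + W)\<^sup>2) + 10 * c ^ 4 * W\<^sup>2 + 4 * c ^ 4 * q\<^sup>2 * g\<^sup>2 + 8 * c ^ 4 * q * (W * g)) / (32 * c ^ 3)"
    using c_pos by simp
  moreover have "(L * c\<^sup>2 * (q * (q * g + W)\<^sup>2) + 2 * c ^ 4 * W\<^sup>2 + 2 * c ^ 4 * q\<^sup>2 * g\<^sup>2) / (32 * c ^ 3)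
      = c / 4 * (q * (L / 2 * ((q * g + W) / (2 * c))\<^sup>2) + 1 / 4 * W\<^sup>2 + 1 / 4 * (q * g)\<^sup>2)"
    using c_pos by (simp add: field_simps power2_eq_square power3_eq_cube power4_eq_xxxx)
  moreover have "(L\<^sup>2 * (q * (q * g + W)\<^sup>2) + 10 * c ^ 4 * W\<^sup>2 + 4 * c ^ 4 * q\<^sup>2 * g\<^sup>2 + 8 * c ^ 4 * q * (W * g)) / (32 * c ^ 3)
      = (10 * c ^ 4 + L\<^sup>2 * q) / (32 * c ^ 3) * W\<^sup>2 + q\<^sup>2 * (4 * c ^ 4 + L\<^sup>2 * q) / (32 * c ^ 3) * g\<^sup>2
        + q * (4 * c ^ 4 + L\<^sup>2 * q) / (16 * c ^ 3) * W * g"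
    using c_pos by (simp add: field_simps power2_eq_square)
  ultimately show ?thesis
    unfolding Bq_ST_eq g_def[symmetric] W_def[symmetric] by simp
qed

text \<open>The terms with the inner product of \<open>gh\<close> and \<open>v\<close> are already
  linear in \<open>t\<close> and are carried over with their sign; only the change of
  \<open>f\<close>, through \<open>descent\<close>, and the change of the kinetic term are
  estimated.\<close>

lemma B_ET_le_ST:
  assumes "t \<ge> 0"
  shows "B_ET \<mu> L s f x v a t \<le> Bq_ST \<mu> L s f x v a * t\<^sup>2 + Bl_ST \<mu> L s f x v a * t"
proof -
  define g W n r where "g = norm (gh x v a)" and "W = norm (u x v a)" and "n = norm v"
    and "r = norm (G x)"
  define h where "h = (q * g + W) / (2 * c)"
  have \<delta>: "norm (X x v a t - x) \<le> t * h"
    using norm_hoh_x_diff(1)[OF assms, of x v a] by (simp add: h_def g_def W_def)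
  have Vd: "norm (V x v a t - v) \<le> t * W"
    using norm_hoh_v_diff(1)[OF assms, of x v a] by (simp add: W_def)
  have "f (X x v a t) - f x \<le> G x \<bullet> (X x v a t - x) + L / 2 * (norm (X x v a t - x))\<^sup>2"
    by (rule descent)
  also have "\<dots> \<le> r * (t * h) + L / 2 * (t * h)\<^sup>2"
    using \<delta> L_pos by (intro add_mono inner_le mult_left_mono power_mono) (auto simp: r_def)
  finally have N1: "q * (f (X x v a t) - f x) \<le> q * (r * (t * h) + L / 2 * (t * h)\<^sup>2)"
    using q_gt_1 by (intro mult_left_mono) auto
  have N2: "(norm (V x v a t))\<^sup>2 - (norm v)\<^sup>2 \<le> (t * W)\<^sup>2 + 2 * (t * W * n)"
  proof -
    have "(norm (V x v a t))\<^sup>2 - (norm v)\<^sup>2 = (norm (V x v a t - v))\<^sup>2 + 2 * ((V x v a t - v) \<bullet> v)"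
      by (simp add: power2_norm_eq_inner inner_simps inner_commute)
    also have "\<dots> \<le> (t * W)\<^sup>2 + 2 * (t * W * n)"
      using Vd by (intro add_mono power_mono mult_left_mono inner_le) (auto simp: n_def)
    finally show ?thesis .
  qed
  have N3: "(norm ((q * t) *\<^sub>R gh x v a))\<^sup>2 = (q * g)\<^sup>2 * t\<^sup>2"
    by (simp add: g_def power_mult_distrib)
  have "B_ET \<mu> L s f x v a t \<le> c / 4 * (q * (r * (t * h) + L / 2 * (t * h)\<^sup>2)
      - c * q * t * (g\<^sup>2 / L) + c * q * t * (a * (gh x v a \<bullet> v))
      + 1 / 4 * ((t * W)\<^sup>2 + 2 * (t * W * n)) + 1 / 4 * ((q * g)\<^sup>2 * t\<^sup>2)
      - 1 / 2 * (q * t) * (gh x v a \<bullet> v))"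
    unfolding B_ET_eq g_def[symmetric] inner_scaleR_right N3
  proof (rule mult_left_mono)
    show "0 \<le> c / 4" using c_pos by simp
  qed (intro diff_right_mono add_mono mult_left_mono N1 N2 order_refl, simp_all)
  also have "\<dots> = c / 4 * (q * (L / 2 * h\<^sup>2) + 1 / 4 * W\<^sup>2 + 1 / 4 * (q * g)\<^sup>2) * t\<^sup>2
      + c * q / 4 * (r * h + 1 / 2 * W * (n / q) - c * (g\<^sup>2 / L) + (a * c - 1 / 2) * (gh x v a \<bullet> v)) * t"
    using q_gt_1 L_pos by (simp add: field_simps power2_eq_square)
  also have "\<dots> \<le> Bq_ST \<mu> L s f x v a * t\<^sup>2
      + c * q / 4 * (r * h + 1 / 2 * W * (n / q) - c * (g\<^sup>2 / L) + (a * c - 1 / 2) * (gh x v a \<bullet> v)) * t"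
    using Bq_ST_ge[of x v a] unfolding h_def g_def W_def
    by (intro add_right_mono mult_right_mono) auto
  also have "r * h + 1 / 2 * W * (n / q) = q / (2 * c) * g * r + 1 / 2 * W * (r / c + n / q)"
    by (simp add: h_def add_divide_distrib algebra_simps)
  finally show ?thesis
    unfolding Bl_ST_eq g_def[symmetric] W_def[symmetric] n_def[symmetric] r_def[symmetric] .
qed

lemma D_ET_le_ST:
  assumes "t \<ge> 0"
  shows "D_ET \<mu> s f x v a t \<le> D_ST \<mu> s f x v a * t"
proof -
  note Vd = norm_hoh_v_diff(1)[OF assms, of x v a]
  have "q * (G x \<bullet> (V x v a t - v)) \<le> q * (norm (G x) * (t * norm (u x v a)))"
    using Vd q_gt_1 by (intro mult_left_mono inner_le) auto
  moreover have "c * (- (v \<bullet> (V x v a t - v))) \<le> c * (norm v * (t * norm (u x v a)))"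
    using Vd c_pos by (intro mult_left_mono minus_inner_le) auto
  ultimately show ?thesis
    unfolding D_ET_eq D_ST_eq by (simp add: algebra_simps)
qed

lemma ET_le_ST:
  assumes "t \<ge> 0"
  shows "bd ET x v a t \<le> bd ST x v a t"
  using A_ET_le_ST[OF assms, of x v a] B_ET_le_ST[OF assms, of x v a] D_ET_le_ST[OF assms, of x v a]
  by (simp add: distrib_right)

lemma lyap_rate_le_bd:
  assumes "t \<ge> 0"
  shows "lyap_rate (gh x v a) (X x v a t) (V x v a t) + c / 4 * lyap (X x v a t) (V x v a t) \<le> bd bnd x v a t"
  using lyap_rate_le_ET[OF assms, of x v a] ET_le_ST[OF assms, of x v a] by (cases bnd) auto

subsection \<open>A state-independent lower bound on the stepsize\<close>

lemma gh_diff_le: "norm (gh x v a - G x) \<le> L * (a * norm v)" if "a \<ge> 0"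
  using lipD[of "x + a *\<^sub>R v" x] that by (simp add: gh_def)

lemma C_bd_le:
  assumes "0 \<le> a" "a \<le> small_a"
  shows "C_bd \<mu> L s f x v a \<le> - (decay_const / 4) * (norm v + norm (G x))\<^sup>2"
proof -
  define n r R where "n = norm v" and "r = norm (G x)" and "R = n + r"
  have nn: "n \<ge> 0" "r \<ge> 0" by (auto simp: n_def r_def)
  have q: "q > 0" using q_gt_1 by simp
  have a1: "a \<le> 1" using assms by (simp add: small_a_def)
  have P: "n * n \<le> R\<^sup>2" "r * n \<le> R\<^sup>2"
    using nn by (auto simp: R_def power2_eq_square intro!: mult_mono)
  have "f x - f (x + a *\<^sub>R v) \<le> - (G x \<bullet> (a *\<^sub>R v))"
  proof -
    have "0 \<le> \<mu> / 2 * (norm (x - (x + a *\<^sub>R v)))\<^sup>2" using mu_pos by simp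
    moreover have "G x \<bullet> (x + a *\<^sub>R v - x) = G x \<bullet> (a *\<^sub>R v)" by simp
    ultimately show ?thesis using strongD[where x=x and y="x + a *\<^sub>R v"] by linarith
  qed
  also have "\<dots> \<le> r * (a * n)"
    using assms by (intro minus_inner_le) (auto simp: r_def n_def)
  also have "\<dots> = a * (r * n)" by simp
  also have "\<dots> \<le> a * R\<^sup>2" using P assms by (intro mult_left_mono) auto
  finally have "c * (f x - f (x + a *\<^sub>R v)) \<le> c * (a * R\<^sup>2)"
    using c_pos by (intro mult_left_mono) auto
  moreover have "c * r * norm (a *\<^sub>R v) \<le> c * (a * R\<^sup>2)"
    using mult_left_mono[OF P(2), of "c * a"] c_pos assms by (simp add: n_def algebra_simps)
  moreover have "- ((gh x v a - G x) \<bullet> v) \<le> L * (a * R\<^sup>2)"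
  proof -
    have "- ((gh x v a - G x) \<bullet> v) \<le> L * (a * n) * n"
      using gh_diff_le[OF assms(1), of x v] by (intro minus_inner_le) (auto simp: n_def)
    also have "\<dots> = L * a * (n * n)" by simp
    also have "\<dots> \<le> L * a * R\<^sup>2" using P L_pos assms by (intro mult_left_mono) auto
    finally show ?thesis by simp
  qed
  moreover have "c * (gh x v a \<bullet> (a *\<^sub>R v)) \<le> c * (a * ((1 + L) * R\<^sup>2))"
  proof (rule mult_left_mono)
    have "norm (gh x v a) \<le> r + L * (a * n)"
      using norm_triangle_ineq[of "G x" "gh x v a - G x"] gh_diff_le[OF assms(1), of x v]
      by (simp add: r_def n_def)
    also have "\<dots> \<le> r + L * (1 * n)"
      using a1 nn L_pos by (intro add_left_mono mult_left_mono mult_right_mono) auto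
    finally have "gh x v a \<bullet> (a *\<^sub>R v) \<le> (r + L * n) * (a * n)"
      using assms by (intro inner_le) (auto simp: n_def)
    also have "\<dots> = a * (r * n + L * (n * n))" by (simp add: algebra_simps)
    also have "\<dots> \<le> a * (R\<^sup>2 + L * R\<^sup>2)"
      using P assms L_pos by (intro mult_left_mono add_mono) auto
    finally show "gh x v a \<bullet> (a *\<^sub>R v) \<le> a * ((1 + L) * R\<^sup>2)" by (simp add: algebra_simps)
  qed (use c_pos in simp)
  moreover have "0 \<le> c ^ 3 / 2 * (norm (a *\<^sub>R v))\<^sup>2" using c_pos by simp
  \<comment> \<open>The four terms caused by \<open>a\<close>: the change of \<open>f\<close>, the
    product of norms, the gradient difference, and the inner product with
    \<open>a *\<^sub>R v\<close>. Their sum is the factor in the denominator of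
    \<open>small_a\<close>.\<close>
  moreover have "c * (a * R\<^sup>2) + c * (a * R\<^sup>2) + L * (a * R\<^sup>2) + c * (a * ((1 + L) * R\<^sup>2))
      = (3 * c + L + c * L) * (a * R\<^sup>2)"
    by (simp add: algebra_simps)
  ultimately have "- (3 * c / 8) * (r\<^sup>2 / L) + c * (f x - f (x + a *\<^sub>R v))
       + c * r * norm (a *\<^sub>R v) - c ^ 3 / 2 * (norm (a *\<^sub>R v))\<^sup>2
       - (gh x v a - G x) \<bullet> v + c * (gh x v a \<bullet> (a *\<^sub>R v))
     \<le> - (3 * c / 8) * (r\<^sup>2 / L) + (3 * c + L + c * L) * (a * R\<^sup>2)" (is "?B \<le> ?B'")
    by linarith
  then have "q * ?B \<le> q * ?B'" using q by (intro mult_left_mono) auto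
  moreover have "0 \<le> c ^ 4 * sqrt s / 2 * (r\<^sup>2 / L\<^sup>2)" using c_pos s_pos by simp
  ultimately have "C_bd \<mu> L s f x v a \<le> - (13 * c / 16) * n\<^sup>2 + q * ?B'"
    unfolding C_bd_eq r_def[symmetric] n_def[symmetric] by linarith
  also have "\<dots> = - (13 * c / 16) * n\<^sup>2 - 3 * c * q / (8 * L) * r\<^sup>2 + q * (3 * c + L + c * L) * a * R\<^sup>2"
    by (simp add: algebra_simps)
  also have "\<dots> \<le> - decay_const * n\<^sup>2 - decay_const * r\<^sup>2 + decay_const / 4 * R\<^sup>2"
  proof (intro add_mono diff_mono mult_right_mono)
    have "0 < q * (3 * c + L + c * L)" using q c_pos L_pos by (simp add: add_pos_pos)
    moreover have "a \<le> decay_const / (4 * q * (3 * c + L + c * L))"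
      using assms by (simp add: small_a_def)
    ultimately show "q * (3 * c + L + c * L) * a \<le> decay_const / 4"
      by (simp add: field_simps)
  qed (auto simp: decay_const_def)
  also have "\<dots> \<le> - (decay_const / 4) * R\<^sup>2"
  proof -
    \<comment> \<open>Passing to the square of the sum halves the decay, and the terms in
      \<open>a\<close> take another quarter of \<open>decay_const\<close>; one quarter
      remains.\<close>
    have "R\<^sup>2 \<le> 2 * n\<^sup>2 + 2 * r\<^sup>2"
      using zero_le_power2[of "n - r"] by (simp add: R_def power2_eq_square algebra_simps)
    from mult_left_mono[OF this, of decay_const] show ?thesis
      using const_pos(3) by (simp add: algebra_simps)
  qed
  finally show ?thesis by (simp add: R_def n_def r_def)
qed

text \<open>For \<open>t \<le> 1\<close> the quadratic term is absorbed into the linear one, its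
  coefficient being nonnegative, and every coefficient is at most a constant times the square of the
  common bound \<open>Y\<close>.\<close>

lemma ST_slope_le:
  assumes "0 \<le> a" "a \<le> 1" "0 \<le> t" "t \<le> 1"
  shows "bd ST x v a t \<le> slope_const * size_const\<^sup>2 * (norm v + norm (G x))\<^sup>2 * t + C_bd \<mu> L s f x v a"
proof -
  define g W n r where "g = norm (gh x v a)" and "W = norm (u x v a)" and "n = norm v"
    and "r = norm (G x)"
  define R Y where "R = n + r" and "Y = size_const * R"
  have q: "q > 0" using q_gt_1 by simp
  have nn: "0 \<le> g" "0 \<le> W" "0 \<le> n" "0 \<le> r" by (auto simp: g_def W_def n_def r_def)
  then have R: "R \<ge> 0" by (simp add: R_def)
  have gR: "g \<le> (1 + L) * R"
  proof -
    have "g \<le> r + L * (a * n)"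
      using norm_triangle_ineq[of "G x" "gh x v a - G x"] gh_diff_le[OF assms(1), of x v]
      by (simp add: g_def r_def n_def)
    also have "\<dots> \<le> r + L * (1 * n)"
      using assms nn L_pos by (intro add_left_mono mult_left_mono mult_right_mono) auto
    also have "\<dots> \<le> (1 + L) * R"
      using nn L_pos by (simp add: R_def algebra_simps)
    finally show ?thesis .
  qed
  have WR: "W \<le> 2 * c * R + q * ((1 + L) * R)"
  proof -
    have "W \<le> 2 * c * n + q * g"
      using norm_triangle_ineq[of "(2 * c) *\<^sub>R v" "q *\<^sub>R gh x v a"] c_pos q
      by (simp add: W_def u_def n_def g_def)
    also have "\<dots> \<le> 2 * c * R + q * ((1 + L) * R)"
      using gR nn c_pos q by (intro add_mono mult_left_mono) (auto simp: R_def)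
    finally show ?thesis .
  qed
  have *: "0 \<le> L * R" "0 \<le> 2 * c * R" "0 \<le> q * ((1 + L) * R)"
    using R L_pos c_pos q by auto
  have Y: "Y = R + L * R + 2 * c * R + q * ((1 + L) * R)"
    by (simp add: Y_def size_const_def algebra_simps)
  have le: "g \<le> Y" "W \<le> Y" "n \<le> Y" "r \<le> Y" and Y0: "0 \<le> Y"
    using gR WR * nn R unfolding Y by (auto simp: R_def distrib_right)
  have pos: "0 \<le> c" "0 \<le> q" "0 \<le> L" using c_pos q L_pos by auto
  have Al: "Al_ST \<mu> L s f x v a \<le> (c + L * q / (2 * c) + 3 * q / 2 + q\<^sup>2 / 2 * (L / c + 1)) * Y\<^sup>2"
  proof -
    have "Al_ST \<mu> L s f x v a \<le> Y * (c * Y + L * q / (2 * c) * Y + 3 * q / 2 * Y) + q\<^sup>2 / 2 * Y * (L / c * Y + Y)"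
      unfolding Al_ST_eq g_def[symmetric] W_def[symmetric] n_def[symmetric]
      using nn Y0 pos by (intro add_mono mult_mono mult_left_mono le) auto
    then show ?thesis by (simp add: power2_eq_square algebra_simps)
  qed
  have Aq: "Aq_ST \<mu> L s f x v a \<le> (L * q / (2 * c) + c + L * q\<^sup>2 / (2 * c)) * Y\<^sup>2"
  proof -
    have "Aq_ST \<mu> L s f x v a \<le> Y * ((L * q / (2 * c) + c) * Y + L * q\<^sup>2 / (2 * c) * Y)"
      unfolding Aq_ST_eq g_def[symmetric] W_def[symmetric]
      using nn Y0 pos by (intro add_mono mult_mono mult_left_mono le) auto
    then show ?thesis by (simp add: power2_eq_square algebra_simps)
  qed
  have Bl: "Bl_ST \<mu> L s f x v a \<le> c * q / 4 * (q / (2 * c) + 1 / 2 * (1 / c + 1 / q) + (c + 1 / 2)) * Y\<^sup>2"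
  proof -
    have "\<bar>gh x v a \<bullet> v\<bar> \<le> Y * Y"
      using Cauchy_Schwarz_ineq2[of "gh x v a" v] mult_mono[OF le(1) le(3) Y0 nn(3)]
      by (simp add: g_def n_def)
    moreover have "\<bar>a * c - 1 / 2\<bar> \<le> c + 1 / 2"
      using assms c_pos mult_right_mono[of a 1 c] mult_nonneg_nonneg[of a c] by linarith
    ultimately have "\<bar>a * c - 1 / 2\<bar> * \<bar>gh x v a \<bullet> v\<bar> \<le> (c + 1 / 2) * (Y * Y)"
      by (intro mult_mono) auto
    then have "(a * c - 1 / 2) * (gh x v a \<bullet> v) \<le> (c + 1 / 2) * (Y * Y)"
      using abs_ge_self[of "(a * c - 1 / 2) * (gh x v a \<bullet> v)"] unfolding abs_mult by linarith
    moreover have "q / (2 * c) * g * r + 1 / 2 * W * (r / c + n / q)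
        \<le> q / (2 * c) * Y * Y + 1 / 2 * Y * (Y / c + Y / q)"
      using nn Y0 pos by (intro add_mono mult_mono mult_left_mono divide_right_mono le) auto
    moreover have "0 \<le> c * (g\<^sup>2 / L)" using pos by simp
    ultimately have "q / (2 * c) * g * r + 1 / 2 * W * (r / c + n / q) - c * (g\<^sup>2 / L)
        + (a * c - 1 / 2) * (gh x v a \<bullet> v)
      \<le> q / (2 * c) * Y * Y + 1 / 2 * Y * (Y / c + Y / q) + (c + 1 / 2) * (Y * Y)"
      by linarith
    then have "Bl_ST \<mu> L s f x v a \<le> c * q / 4 *
        (q / (2 * c) * Y * Y + 1 / 2 * Y * (Y / c + Y / q) + (c + 1 / 2) * (Y * Y))"
      unfolding Bl_ST_eq g_def[symmetric] W_def[symmetric] n_def[symmetric] r_def[symmetric]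
      by (rule mult_left_mono) (use pos in simp)
    also have "q / (2 * c) * Y * Y + 1 / 2 * Y * (Y / c + Y / q) + (c + 1 / 2) * (Y * Y)
        = (q / (2 * c) + 1 / 2 * (1 / c + 1 / q) + (c + 1 / 2)) * Y\<^sup>2"
      by (simp add: power2_eq_square algebra_simps add_divide_distrib)
    finally show ?thesis by simp
  qed
  have Bq: "Bq_ST \<mu> L s f x v a \<le> ((10 * c ^ 4 + L\<^sup>2 * q) / (32 * c ^ 3)
      + q\<^sup>2 * (4 * c ^ 4 + L\<^sup>2 * q) / (32 * c ^ 3) + q * (4 * c ^ 4 + L\<^sup>2 * q) / (16 * c ^ 3)) * Y\<^sup>2"
  proof -
    have "Bq_ST \<mu> L s f x v a \<le> (10 * c ^ 4 + L\<^sup>2 * q) / (32 * c ^ 3) * Y\<^sup>2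
      + q\<^sup>2 * (4 * c ^ 4 + L\<^sup>2 * q) / (32 * c ^ 3) * Y\<^sup>2 + q * (4 * c ^ 4 + L\<^sup>2 * q) / (16 * c ^ 3) * Y * Y"
      unfolding Bq_ST_eq g_def[symmetric] W_def[symmetric]
      using nn Y0 pos by (intro add_mono mult_mono mult_left_mono power_mono le) auto
    then show ?thesis by (simp only: distrib_right power2_eq_square mult.assoc)
  qed
  have D: "D_ST \<mu> s f x v a \<le> (q + c) * Y\<^sup>2"
  proof -
    have "D_ST \<mu> s f x v a \<le> Y * (q * Y + c * Y)"
      unfolding D_ST_eq W_def[symmetric] n_def[symmetric] r_def[symmetric]
      using nn Y0 pos by (intro add_mono mult_mono mult_left_mono le) auto
    then show ?thesis by (simp add: power2_eq_square algebra_simps)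
  qed
  have "0 \<le> Aq_ST \<mu> L s f x v a + Bq_ST \<mu> L s f x v a"
    unfolding Aq_ST_eq Bq_ST_eq using pos
    by (intro add_nonneg_nonneg mult_nonneg_nonneg divide_nonneg_nonneg) auto
  moreover have "t\<^sup>2 \<le> t" using assms by (simp add: power2_eq_square mult_left_le)
  ultimately have "(Aq_ST \<mu> L s f x v a + Bq_ST \<mu> L s f x v a) * t\<^sup>2
      \<le> (Aq_ST \<mu> L s f x v a + Bq_ST \<mu> L s f x v a) * t"
    by (intro mult_left_mono)
  moreover have "(Aq_ST \<mu> L s f x v a + Bq_ST \<mu> L s f x v a + (Al_ST \<mu> L s f x v a + Bl_ST \<mu> L s f x v a
      + D_ST \<mu> s f x v a)) * t \<le> slope_const * Y\<^sup>2 * t"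
  proof (rule mult_right_mono[OF _ assms(3)])
    have "y2 + y4 + (y1 + y3 + y5) \<le> (k1 + k2 + k3 + k4 + k5) * w"
      if "y1 \<le> k1 * w" "y2 \<le> k2 * w" "y3 \<le> k3 * w" "y4 \<le> k4 * w" "y5 \<le> k5 * w"
      for y1 y2 y3 y4 y5 k1 k2 k3 k4 k5 w :: real
      using that by (simp add: distrib_right)
    from this[OF Al Aq Bl Bq D]
    show "Aq_ST \<mu> L s f x v a + Bq_ST \<mu> L s f x v a + (Al_ST \<mu> L s f x v a + Bl_ST \<mu> L s f x v a
      + D_ST \<mu> s f x v a) \<le> slope_const * Y\<^sup>2"
      unfolding slope_const_def .
  qed
  ultimately have "bd ST x v a t \<le> slope_const * Y\<^sup>2 * t + C_bd \<mu> L s f x v a"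
    by (simp add: distrib_right)
  then show ?thesis by (simp add: Y_def R_def n_def r_def power_mult_distrib mult_ac)
qed

lemma bd_neg_below_MIET:
  assumes "0 \<le> a" "a \<le> small_a" "G x \<noteq> 0" "0 \<le> t" "t < MIET"
  shows "bd bnd x v a t < 0"
proof -
  define R2 where "R2 = (norm v + norm (G x))\<^sup>2"
  have "norm v + norm (G x) > 0" using assms by (simp add: add_nonneg_pos)
  then have R2: "R2 > 0" by (simp add: R2_def)
  define K where "K = slope_const * size_const\<^sup>2"
  have K: "K > 0" using const_pos by (simp add: K_def)
  have a: "a \<le> 1" and t: "t \<le> 1" "t < decay_const / (4 * K)"
    using assms by (auto simp: small_a_def MIET_def K_def)
  have "K * t < decay_const / 4" using t(2) K by (simp add: field_simps)
  then have "K * t * R2 < decay_const / 4 * R2" using R2 by (rule mult_strict_right_mono)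
  moreover have "bd ST x v a t \<le> K * R2 * t + C_bd \<mu> L s f x v a"
    using ST_slope_le[OF assms(1) a assms(4) t(1), of x v] by (simp add: K_def R2_def)
  moreover have "C_bd \<mu> L s f x v a \<le> - (decay_const / 4) * R2"
    using C_bd_le[OF assms(1,2), of x v] by (simp add: R2_def)
  moreover have "K * t * R2 = K * R2 * t" by simp
  ultimately have "bd ST x v a t < 0" by linarith
  then show ?thesis using ET_le_ST[OF assms(4), of x v a] by (cases bnd) auto
qed

subsection \<open>Existence of the stepsize\<close>

lemma continuous_X: "continuous_on S (X x v a)"
  and continuous_V: "continuous_on S (V x v a)"
proof -
  show "continuous_on S (X x v a)"
    by (intro continuous_at_imp_continuous_on ballI has_vector_derivative_continuous[OF hoh_ode(1)[OF mu_pos]])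
  show "continuous_on S (V x v a)"
    by (intro continuous_at_imp_continuous_on ballI has_vector_derivative_continuous[OF hoh_ode(2)[OF mu_pos]])
qed

lemma continuous_bd: "continuous_on S (bd bnd x v a)"
proof (cases bnd)
  case ET
  have "continuous_on S (\<lambda>t. A_ET \<mu> s f x v a t + B_ET \<mu> L s f x v a t + C_bd \<mu> L s f x v a + D_ET \<mu> s f x v a t)"
    unfolding A_ET_eq B_ET_eq D_ET_eq using L_pos
    by (intro continuous_intros continuous_X continuous_V continuous_on_compose2[OF continuous_G continuous_X]
        continuous_on_compose2[OF continuous_f continuous_X]) auto
  then show ?thesis using ET by simp
next
  case ST
  have "continuous_on S (\<lambda>t. (Aq_ST \<mu> L s f x v a + Bq_ST \<mu> L s f x v a) * t\<^sup>2
      + (Al_ST \<mu> L s f x v a + Bl_ST \<mu> L s f x v a + D_ST \<mu> s f x v a) * t + C_bd \<mu> L s f x v a)"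
    by (intro continuous_intros)
  then show ?thesis using ST by simp
qed

lemma bd_0: "bd bnd x v a 0 = C_bd \<mu> L s f x v a"
  by (cases bnd) (simp_all add: A_ET_eq B_ET_eq D_ET_eq hoh_initial)

lemma bd_ST_eventually_ge:
  assumes "G x \<noteq> 0"
  shows "eventually (\<lambda>t. bd ST x v a t \<ge> 1) at_top"
proof -
  have pos: "0 < c" "0 < q" "0 < L" using c_pos q_gt_1 L_pos by auto
  \<comment> \<open>If both vanished, then \<open>v = 0\<close> and the sampled gradient would be
    \<open>G x\<close>.\<close>
  have "gh x v a \<noteq> 0 \<or> u x v a \<noteq> 0"
    using assms c_pos by (cases "v = 0") (auto simp: gh_def u_def)
  then have "0 < Bq_ST \<mu> L s f x v a"
  proof
    assume "gh x v a \<noteq> 0"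
    then show ?thesis unfolding Bq_ST_eq using pos
      by (intro add_pos_nonneg add_nonneg_pos mult_pos_pos mult_nonneg_nonneg divide_nonneg_nonneg
          divide_pos_pos) auto
  next
    assume "u x v a \<noteq> 0"
    then show ?thesis unfolding Bq_ST_eq using pos
      by (intro add_pos_nonneg mult_pos_pos mult_nonneg_nonneg divide_nonneg_nonneg
          divide_pos_pos) (auto intro: add_pos_pos)
  qed
  moreover have "0 \<le> Aq_ST \<mu> L s f x v a"
    unfolding Aq_ST_eq using pos by auto
  ultimately have "0 < Aq_ST \<mu> L s f x v a + Bq_ST \<mu> L s f x v a" by simp
  from eventually_quadratic_ge[OF this, of "- (Al_ST \<mu> L s f x v a + Bl_ST \<mu> L s f x v a + D_ST \<mu> s f x v a)"
      "- C_bd \<mu> L s f x v a"]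
  show ?thesis by eventually_elim (simp add: algebra_simps)
qed

text \<open>The velocity stays bounded by \<open>M\<close> and the distance to \<open>xs\<close> by
  \<open>A * t + B\<close>, so \<open>lyap_rate\<close> falls at most linearly, whereas the last
  square of \<open>lyap\<close> contributes \<open>\<alpha> * t^2\<close>.\<close>

lemma bd_ET_eventually_ge:
  assumes "gh x v a \<noteq> 0"
  shows "eventually (\<lambda>t. bd ET x v a t \<ge> 1) at_top"
proof -
  have pos: "0 < c" "0 < q" "0 < L" using c_pos q_gt_1 L_pos by auto
  define g M A B z where "g = norm (gh x v a)" and "M = norm v + norm (u x v a) / (2 * c)"
    and "A = q * norm (gh x v a) / (2 * c)"
    and "B = norm (u x v a) / (4 * c\<^sup>2) + norm (x - xs)"
    and "z = v + (2 * c) *\<^sub>R (x - xs)"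
  define \<alpha> \<beta> \<gamma> where "\<alpha> = c / 16 * (q * g)\<^sup>2"
    and "\<beta> = q * (L * A * M) + c * q * (A * g) + c / 8 * (q * (g * norm z))"
    and "\<gamma> = q * (L * B * M) + c * M\<^sup>2 + q * (M * g) + c * q * (B * g)"
  have bound: "\<alpha> * t\<^sup>2 - \<beta> * t - \<gamma> \<le> bd ET x v a t" if t: "t \<ge> 0" for t
  proof -
    define x' v' where "x' = X x v a t" and "v' = V x v a t"
    have V: "norm v' \<le> M"
      using norm_triangle_ineq[of v "v' - v"] norm_hoh_v_diff(2)[OF t, of x v a]
      by (simp add: M_def v'_def)
    have X: "norm (x' - xs) \<le> A * t + B"
      using norm_triangle_ineq[of "x' - x" "x - xs"] norm_hoh_x_diff(2)[OF t, of x v a]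
      by (simp add: A_def B_def x'_def)
    have "norm (G x') \<le> L * (A * t + B)"
      using X pos by (intro order_trans[OF G_le] mult_left_mono) auto
    from minus_inner_le[OF this V]
    have p1: "q * (- (G x' \<bullet> v')) \<le> q * (L * (A * t + B) * M)"
      using pos by (intro mult_left_mono) auto
    have p2: "c * (norm v')\<^sup>2 \<le> c * M\<^sup>2"
      using V pos by (intro mult_left_mono power_mono) auto
    have p3: "q * (v' \<bullet> gh x v a) \<le> q * (M * g)"
      using V pos by (intro mult_left_mono inner_le) (auto simp: g_def)
    have p4: "c * q * ((x' - xs) \<bullet> gh x v a) \<le> c * q * ((A * t + B) * g)"
      using X pos by (intro mult_left_mono inner_le) (auto simp: g_def)
    have "v' + (2 * c) *\<^sub>R (x' - xs) = z - (q * t) *\<^sub>R gh x v a"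
      using hoh_drift[of x v a t] by (simp add: z_def x'_def v'_def algebra_simps)
    then have "(norm (v' + (2 * c) *\<^sub>R (x' - xs)))\<^sup>2
        = (norm z)\<^sup>2 - 2 * (q * t) * (gh x v a \<bullet> z) + (q * t)\<^sup>2 * g\<^sup>2"
      unfolding g_def by (simp only: power2_norm_eq_inner)
        (simp add: inner_simps inner_commute power2_eq_square)
    moreover have "2 * (q * t) * (gh x v a \<bullet> z) \<le> 2 * (q * t) * (g * norm z)"
      using pos t by (intro mult_left_mono inner_le) (auto simp: g_def)
    moreover have "0 \<le> (norm z)\<^sup>2" by simp
    ultimately have "(q * t)\<^sup>2 * g\<^sup>2 - 2 * (q * t) * (g * norm z) \<le> (norm (v' + (2 * c) *\<^sub>R (x' - xs)))\<^sup>2"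
      by linarith
    also have "\<dots> \<le> 4 * lyap x' v'"
      using min[of x'] pos by (simp add: lyap_def)
    finally have "c / 16 * ((q * t)\<^sup>2 * g\<^sup>2 - 2 * (q * t) * (g * norm z)) \<le> c / 16 * (4 * lyap x' v')"
      using pos by (intro mult_left_mono) auto
    then have p5: "\<alpha> * t\<^sup>2 - c / 8 * (q * (g * norm z)) * t \<le> c / 4 * lyap x' v'"
      by (simp add: \<alpha>_def power_mult_distrib algebra_simps)
    have "\<beta> * t + \<gamma> = q * (L * (A * t + B) * M) + c * M\<^sup>2 + q * (M * g) + c * q * ((A * t + B) * g)
        + c / 8 * (q * (g * norm z)) * t"
      by (simp add: \<beta>_def \<gamma>_def algebra_simps)
    moreover have "q * (- (G x' \<bullet> v')) = - (q * (G x' \<bullet> v'))" by simp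
    ultimately have "\<alpha> * t\<^sup>2 - \<beta> * t - \<gamma> \<le> lyap_rate (gh x v a) x' v' + c / 4 * lyap x' v'"
      unfolding lyap_rate_def using p1 p2 p3 p4 p5 by linarith
    then show ?thesis
      using lyap_rate_le_ET[OF t, of x v a] by (simp add: x'_def v'_def)
  qed
  have "\<alpha> > 0" using assms pos by (simp add: \<alpha>_def g_def)
  from eventually_quadratic_ge[OF this, of \<beta> \<gamma>] eventually_ge_at_top[of 0]
  show ?thesis by eventually_elim (use bound in force)
qed

text \<open>If \<open>gh x v a = 0\<close> the trajectory converges and \<open>bd ET\<close> stays bounded: only its limit
  can be shown to be positive, and the Lyapunov bound alone does not suffice, since the limit
  point may be the minimizer.\<close>

lemma bd_ET_eventually_ge_stationary:
  assumes g0: "gh x v a = 0" and "G x \<noteq> 0" and "a \<ge> 0"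
  shows "eventually (\<lambda>t. bd ET x v a t \<ge> c / 16 * (norm v)\<^sup>2) at_top" and "v \<noteq> 0"
proof -
  have pos: "0 < c" "0 < q" "0 < L" using c_pos q_gt_1 L_pos by auto
  show v0: "v \<noteq> 0" using assms by (auto simp: gh_def)
  define n p r B where "n = norm v" and "p = norm (a *\<^sub>R v)" and "r = norm (G x)"
    and "B = norm (x - xs) + n / (2 * c)"
  have "\<mu> * norm (x + a *\<^sub>R v - xs) \<le> 0"
    using G_ge[of "x + a *\<^sub>R v"] g0 by (simp add: gh_def)
  \<comment> \<open>The gradient vanishes only at the minimizer, so \<open>gh = 0\<close> places the
    displaced point exactly at \<open>xs\<close>.\<close>
  then have y: "x + a *\<^sub>R v = xs" using mu_pos by (simp add: mult_le_0_iff)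
  then have "x - xs = - (a *\<^sub>R v)" by (simp add: algebra_simps)
  then have p: "p = norm (x - xs)" by (simp add: p_def)
  have "c\<^sup>2 * p \<le> r" using G_ge[of x] by (simp add: r_def p mu_eq[symmetric])
  then have "c * q * p * (c\<^sup>2 * p) \<le> c * q * p * r" using pos by (intro mult_left_mono) (auto simp: p_def)
  then have T1: "q * (c ^ 3 * p\<^sup>2) \<le> q * (c * r * p)"
    by (simp add: power2_eq_square power3_eq_cube algebra_simps)
  have "r\<^sup>2 \<le> (L * p)\<^sup>2"
    using G_le[of x] by (intro power_mono) (auto simp: r_def p)
  then have "r\<^sup>2 / L\<^sup>2 \<le> p\<^sup>2"
    using L_pos by (simp add: field_simps power_mult_distrib)
  then have "c ^ 4 * sqrt s / 2 * (r\<^sup>2 / L\<^sup>2) \<le> c ^ 4 * sqrt s / 2 * p\<^sup>2"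
    using s_pos by (intro mult_left_mono) auto
  also have "\<dots> = q * (c ^ 3 / 2 * p\<^sup>2) - c ^ 3 * p\<^sup>2 / 2"
    by (simp add: q_eq power4_eq_xxxx power3_eq_cube power2_eq_square algebra_simps)
  also have "\<dots> \<le> q * (c ^ 3 / 2 * p\<^sup>2)"
    using pos by simp
  finally have T2: "c ^ 4 * sqrt s / 2 * (r\<^sup>2 / L\<^sup>2) \<le> q * (c ^ 3 / 2 * p\<^sup>2)" .
  have "c * q * (r\<^sup>2 / L / 2) \<le> c * q * (f x - f xs)"
    using gap_ge[of x] pos by (intro mult_left_mono) (auto simp: r_def mult.commute)
  then have T3: "q * (3 * c / 8 * (r\<^sup>2 / L)) \<le> 3 / 4 * (c * q * (f x - f xs))"
    by simp
  have C: "C_bd \<mu> L s f x v a = - 13 / 16 * (c * n\<^sup>2) - c ^ 4 * sqrt s / 2 * (r\<^sup>2 / L\<^sup>2)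
      - q * (3 * c / 8 * (r\<^sup>2 / L)) + c * q * (f x - f xs) + q * (c * r * p) - q * (c ^ 3 / 2 * p\<^sup>2)
      + q * (G x \<bullet> v)"
    unfolding C_bd_eq g0 y n_def[symmetric] r_def[symmetric] p_def[symmetric]
    by (simp add: algebra_simps)
  have T4: "q * (c ^ 3 * p\<^sup>2) = 2 * (q * (c ^ 3 / 2 * p\<^sup>2))" by simp
  define K where "K = q * (L * B * n) + c * n\<^sup>2"
  have bound: "c / 8 * n\<^sup>2 - exp (- 2 * c * t) * K \<le> bd ET x v a t" if t: "t \<ge> 0" for t
  proof -
    define e where "e = exp (- 2 * c * t)"
    have e: "0 \<le> e" "e \<le> 1" using pos t by (auto simp: e_def)
    have V: "V x v a t = e *\<^sub>R v"
    proof -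
      have "(1 - e) / (2 * c) * (2 * c) = 1 - e" using pos by simp
      then have "V x v a t - v = - (1 - e) *\<^sub>R v"
        unfolding hoh_v_diff e_def[symmetric] by (simp add: u_def g0)
      then show ?thesis by (simp add: algebra_simps)
    qed
    have "X x v a t - x = ((1 - e) / (2 * c)) *\<^sub>R v"
    proof -
      have "(1 - e) / (4 * c\<^sup>2) * (2 * c) = (1 - e) / (2 * c)"
        using pos by (simp add: field_simps power2_eq_square)
      then show ?thesis
        unfolding hoh_x_diff e_def[symmetric] by (simp add: u_def g0)
    qed
    then have "norm (X x v a t - x) = (1 - e) * n / (2 * c)"
      using e pos by (simp add: n_def)
    also have "\<dots> \<le> 1 * n / (2 * c)"
      using e pos by (intro divide_right_mono mult_right_mono) (auto simp: n_def)
    finally have "norm (X x v a t - xs) \<le> B"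
      using norm_triangle_ineq[of "X x v a t - x" "x - xs"] by (simp add: B_def)
    then have "norm (G (X x v a t)) \<le> L * B"
      using pos by (intro order_trans[OF G_le] mult_left_mono) auto
    then have "- (G (X x v a t) \<bullet> v) \<le> L * B * n"
      by (rule minus_inner_le) (simp add: n_def)
    then have "(q * e) * (- (G (X x v a t) \<bullet> v)) \<le> (q * e) * (L * B * n)"
      using pos e by (intro mult_left_mono) auto
    then have S1: "- (e * (q * (L * B * n))) \<le> q * (G (X x v a t) \<bullet> V x v a t)"
      by (simp add: V algebra_simps)
    have "e * e \<le> e" using e by (simp add: mult_left_le)
    then have "c * n\<^sup>2 * (e * e) \<le> c * n\<^sup>2 * e" using pos by (intro mult_left_mono) auto
    moreover have "(norm (V x v a t))\<^sup>2 = e * e * n\<^sup>2"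
      using e by (simp add: V n_def power2_eq_square)
    ultimately have S2: "c * (norm (V x v a t))\<^sup>2 \<le> e * (c * n\<^sup>2)"
      by (simp add: algebra_simps)
    have S2': "0 \<le> c * (norm (V x v a t))\<^sup>2" using pos by simp
    have S3: "c * q * (f (X x v a t) - f x) = c * q * (f (X x v a t) - f xs) - c * q * (f x - f xs)"
      by (simp add: algebra_simps)
    have S4: "0 \<le> c * q * (f (X x v a t) - f xs)"
      using min pos by simp
    have AD: "A_ET \<mu> s f x v a t + D_ET \<mu> s f x v a t
        = q * (G (X x v a t) \<bullet> V x v a t) - c * (norm (V x v a t))\<^sup>2 - q * (G x \<bullet> v) + c * n\<^sup>2"
      by (simp add: AD_ET_eq lyap_rate_def g0 n_def)
    have BE: "B_ET \<mu> L s f x v a t = 1 / 4 * (c * q * (f (X x v a t) - f x))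
        + 1 / 16 * (c * (norm (V x v a t))\<^sup>2) - 1 / 16 * (c * n\<^sup>2)"
      by (simp add: B_ET_eq g0 n_def algebra_simps)
    \<comment> \<open>The kinetic coefficients sum to \<open>1 - 1 / 16 - 13 / 16 = 1 / 8\<close>,
      the inner product of \<open>G x\<close> and \<open>v\<close> cancels, and the three quarters
      of the gap left over cover \<open>s2\<close>. What depends on the current velocity decays like
      \<open>e\<close> and goes into \<open>K\<close>.\<close>
    have linear: "1 / 8 * m - (k1 + k2) \<le> GV - m' - Gv + m + (1 / 4 * (d' - d) + 1 / 16 * m' - 1 / 16 * m)
        + (- 13 / 16 * m - s1 - s2 + d + s3 - s4 + Gv)"
      if "s5 \<le> s3" "s1 \<le> s4" "s2 \<le> 3 / 4 * d" "s5 = 2 * s4" "- k1 \<le> GV" "m' \<le> k2" "0 \<le> m'" "0 \<le> d'"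
      for m k1 k2 GV m' Gv d' d s1 s2 s3 s4 s5 :: real
      using that by argo
    have "bd ET x v a t = (A_ET \<mu> s f x v a t + D_ET \<mu> s f x v a t) + B_ET \<mu> L s f x v a t + C_bd \<mu> L s f x v a"
      by simp
    moreover have "exp (- 2 * c * t) * K = e * (q * (L * B * n)) + e * (c * n\<^sup>2)"
      by (simp add: K_def e_def distrib_left)
    moreover have "c / 8 * n\<^sup>2 = 1 / 8 * (c * n\<^sup>2)" by simp
    ultimately show ?thesis
      using linear[OF T1 T2 T3 T4 S1 S2 S2' S4] unfolding AD BE C S3 by (simp only:)
  qed
  have n: "n > 0" using v0 by (simp add: n_def)
  have K: "K \<ge> 0" unfolding K_def B_def using pos n by auto
  \<comment> \<open>From \<open>exp (- y) * y \<le> 1\<close> at \<open>y = 2 * c * t\<close>: past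
    this time the decaying term costs at most half of \<open>c / 8 * n^2\<close>.\<close>
  have "eventually (\<lambda>t. t \<ge> K / (2 * c * (c / 16 * n\<^sup>2))) at_top" by (rule eventually_ge_at_top)
  with eventually_ge_at_top[of 0]
  show "eventually (\<lambda>t. bd ET x v a t \<ge> c / 16 * (norm v)\<^sup>2) at_top"
  proof eventually_elim
    case (elim t)
    have K': "K \<le> 2 * c * t * (c / 16 * n\<^sup>2)"
      using elim pos n by (simp add: field_simps)
    have "exp (- 2 * c * t) * (2 * c * t) \<le> exp (- 2 * c * t) * exp (2 * c * t)"
    proof (rule mult_left_mono)
      show "2 * c * t \<le> exp (2 * c * t)"
        using exp_ge_add_one_self[of "2 * c * t"] by linarith
    qed simp
    then have E: "exp (- 2 * c * t) * (2 * c * t) \<le> 1" by (simp add: exp_minus)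
    have "exp (- 2 * c * t) * K \<le> exp (- 2 * c * t) * (2 * c * t * (c / 16 * n\<^sup>2))"
      using K' by (intro mult_left_mono) auto
    also have "\<dots> = exp (- 2 * c * t) * (2 * c * t) * (c / 16 * n\<^sup>2)" by simp
    also have "\<dots> \<le> 1 * (c / 16 * n\<^sup>2)"
      using E pos by (intro mult_right_mono) auto
    finally show ?case using bound[of t] elim by (simp add: n_def)
  qed
qed

lemma bd_eventually_ge:
  assumes "G x \<noteq> 0" "a \<ge> 0"
  shows "\<exists>\<delta>>0. eventually (\<lambda>t. bd bnd x v a t \<ge> \<delta>) at_top"
proof (cases bnd)
  case ET
  show ?thesis
  proof (cases "gh x v a = 0")
    case True
    show ?thesis
      using bd_ET_eventually_ge_stationary[OF True assms] c_pos ET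
      by (intro exI[of _ "c / 16 * (norm v)\<^sup>2"]) auto
  next
    case False
    show ?thesis using bd_ET_eventually_ge[OF False] ET by (intro exI[of _ 1]) auto
  qed
next
  case ST
  show ?thesis using bd_ST_eventually_ge[OF assms(1)] ST by (intro exI[of _ 1]) auto
qed

abbreviation "bf \<equiv> b_fun \<mu> L s f"
abbreviation "step \<equiv> is_step \<mu> L s f"

lemma bf_Perf: "bf Perf bnd x v a t = integral {0..t} (\<lambda>z. exp (c / 4 * z) * bd bnd x v a z)"
  by (simp add: c_def)

lemma weighted_bd_integrable: "(\<lambda>z. exp (k * z) * bd bnd x v a z) integrable_on {y..w}"
  by (intro integrable_continuous_interval continuous_intros continuous_bd)

lemma continuous_bf: "continuous_on {0..T} (bf trg bnd x v a)"
proof (cases trg)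
  case Deriv
  have "bf Deriv bnd x v a = bd bnd x v a" by (rule ext) simp
  then show ?thesis using Deriv continuous_bd by simp
next
  case Perf
  have "bf Perf bnd x v a = (\<lambda>t. integral {0..t} (\<lambda>z. exp (c / 4 * z) * bd bnd x v a z))"
    by (rule ext) (rule bf_Perf)
  then show ?thesis
    unfolding Perf by (simp only: indefinite_integral_continuous_1[OF weighted_bd_integrable])
qed

text \<open>Negativity passes to the weighted integral, so one time interval serves both
  triggers.\<close>

lemma bf_neg:
  assumes "\<And>z. 0 \<le> z \<Longrightarrow> z < M \<Longrightarrow> bd bnd x v a z < 0" and "0 < t" "t < M"
  shows "bf trg bnd x v a t < 0"
proof (cases trg)
  case Deriv
  then show ?thesis using assms by simp
next
  case Perf
  have "bf Perf bnd x v a t < 0"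
    unfolding bf_Perf using assms by (intro weighted_integral_neg continuous_bd) auto
  then show ?thesis using Perf by simp
qed

lemma step_ge:
  assumes "\<And>z. 0 \<le> z \<Longrightarrow> z < M \<Longrightarrow> bd bnd x v a z < 0" and "step trg bnd x v a \<Delta>"
  shows "\<Delta> \<ge> M"
  using bf_neg[of M bnd x v a \<Delta> trg] assms by (force simp: is_step_def)

lemma step_exists:
  assumes "G x \<noteq> 0" "a \<ge> 0" and C: "C_bd \<mu> L s f x v a < 0"
  shows "\<exists>\<Delta>. step trg bnd x v a \<Delta>"
proof -
  have "isCont (bd bnd x v a) 0"
    using continuous_bd[of UNIV] by (simp add: continuous_on_eq_continuous_at)
  then have "eventually (\<lambda>z. bd bnd x v a z < 0) (at 0)"
    unfolding isCont_def by (rule order_tendstoD(2)) (use C bd_0 in simp)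
  then obtain \<eta> where \<eta>: "\<eta> > 0" "\<And>z. z \<noteq> 0 \<Longrightarrow> dist z 0 < \<eta> \<Longrightarrow> bd bnd x v a z < 0"
    unfolding eventually_at by auto
  have neg: "bd bnd x v a z < 0" if "0 \<le> z" "z < \<eta>" for z
    using \<eta>(2)[of z] C bd_0[of bnd x v a] that by (cases "z = 0") auto
  \<comment> \<open>A uniform positive bound, rather than mere positivity, lets the integral of
    \<open>Perf\<close> outgrow its initial part.\<close>
  obtain \<delta> where \<delta>: "\<delta> > 0" "eventually (\<lambda>t. bd bnd x v a t \<ge> \<delta>) at_top"
    using bd_eventually_ge[OF assms(1,2)] by blast
  then obtain T0 where T0: "\<And>t. t \<ge> T0 \<Longrightarrow> bd bnd x v a t \<ge> \<delta>"
    unfolding eventually_at_top_linorder by blast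
  define T where "T = max 1 T0"
  have T: "T > 0" "\<And>t. t \<ge> T \<Longrightarrow> bd bnd x v a t \<ge> \<delta>"
    using T0 by (auto simp: T_def)
  have "\<exists>T>0. bf trg bnd x v a T > 0"
  proof (cases trg)
    case Deriv
    then show ?thesis using T(1) T(2)[of T] \<delta>(1) by (intro exI[of _ T]) auto
  next
    case Perf
    then show ?thesis
      using weighted_integral_eventually_pos[OF continuous_bd T(1) \<delta>(1) _ T(2), of "c / 4"] c_pos bf_Perf
      by simp
  qed
  then obtain T' where T': "T' > 0" "bf trg bnd x v a T' > 0" by blast
  have "bf trg bnd x v a t < 0" if "0 < t" "t < \<eta>" for t
    using neg that by (rule bf_neg)
  from first_positive_zero[OF continuous_bf \<eta>(1) this T']
  show ?thesis unfolding is_step_def .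
qed

text \<open>Geometric decrease brings the parameter below \<open>small_a\<close>, where it is
  accepted since the stepsize is at least \<open>MIET\<close>. The least accepted index is the
  stopping index: at earlier values a stepsize exists whenever \<open>C_bd < 0\<close>, so failing
  acceptance means rejection and the search is never stuck.\<close>

lemma search_stops_exists:
  assumes "G x \<noteq> 0" "p \<ge> 0" "0 < rd" "rd < 1" "\<tau> \<le> MIET"
  shows "\<exists>m. search_stops \<mu> L s f trg bnd \<tau> rd x v p m"
proof -
  let ?acc = "\<lambda>m. accepts \<mu> L s f trg bnd \<tau> x v (p * rd ^ m)"
  have nonneg: "p * rd ^ m \<ge> 0" for m using assms by simp
  have "(\<lambda>m. p * rd ^ m) \<longlonglongrightarrow> p * 0"
    using assms by (intro tendsto_mult_left LIMSEQ_power_zero) auto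
  then have "eventually (\<lambda>m. p * rd ^ m < small_a) sequentially"
    using const_pos(4) by (intro order_tendstoD(2)) auto
  then obtain m where m: "p * rd ^ m < small_a"
    unfolding eventually_sequentially by blast
  have neg: "bd bnd x v (p * rd ^ m) z < 0" if "0 \<le> z" "z < MIET" for z
    using bd_neg_below_MIET[OF nonneg less_imp_le[OF m] assms(1) that] .
  have C: "C_bd \<mu> L s f x v (p * rd ^ m) < 0"
    using neg[of 0] const_pos(5) bd_0[of bnd x v "p * rd ^ m"] by simp
  obtain \<Delta> where \<Delta>: "step trg bnd x v (p * rd ^ m) \<Delta>"
    using step_exists[OF assms(1) nonneg C] by blast
  with step_ge[OF neg \<Delta>] C assms(5) have "?acc m"
    unfolding accepts_def by (meson order_trans)
  then have "?acc (Least ?acc)" by (rule LeastI)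
  moreover have "rejects \<mu> L s f trg bnd \<tau> x v (p * rd ^ j)" if "j < Least ?acc" for j
    using not_less_Least[OF that] step_exists[OF assms(1) nonneg[of j], of v trg bnd]
    unfolding accepts_def rejects_def by (meson not_less)
  ultimately show ?thesis unfolding search_stops_def by blast
qed

subsection \<open>Runs of the algorithm\<close>

lemma is_step_unique: "step trg bnd x v a \<Delta> \<Longrightarrow> step trg bnd x v a \<Delta>' \<Longrightarrow> \<Delta> = \<Delta>'"
  unfolding is_step_def by (meson order_antisym)

text \<open>The bound starts at \<open>C_bd < 0\<close>, so a positive value would force a zero
  strictly before the first one.\<close>

lemma Deriv_step_bd_nonpos:
  assumes "C_bd \<mu> L s f x v a < 0" "step Deriv bnd x v a \<Delta>" "0 \<le> z" "z \<le> \<Delta>"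
  shows "bd bnd x v a z \<le> 0"
proof (rule ccontr)
  assume "\<not> bd bnd x v a z \<le> 0"
  then have z: "0 < bd bnd x v a z" by simp
  then have "\<exists>w\<ge>0. w \<le> z \<and> bd bnd x v a w = 0"
    using assms bd_0[of bnd x v a] by (intro IVT' continuous_bd) auto
  then obtain w where w: "0 \<le> w" "w \<le> z" "bd bnd x v a w = 0" by blast
  have "w \<noteq> 0" using w assms(1) bd_0[of bnd x v a] by auto
  then have "bf Deriv bnd x v a w = 0" "w > 0" using w by auto
  then have "\<Delta> \<le> w" using assms(2) unfolding is_step_def by blast
  then have "w = z" using w assms(4) by simp
  then show False using w z by simp
qed

text \<open>The weighted function \<open>F\<close> grows by at most the weighted integral of the
  bound. For \<open>Perf\<close> this integral is zero by the definition of the stepsize, whatever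
  the sign of the bound in between; for \<open>Deriv\<close> the integrand is nonpositive.\<close>

lemma lyap_decay:
  assumes C: "C_bd \<mu> L s f x v a < 0" and step: "step trg bnd x v a \<Delta>"
  shows "lyap (X x v a \<Delta>) (V x v a \<Delta>) \<le> exp (- (c / 4) * \<Delta>) * lyap x v"
proof -
  have \<Delta>: "\<Delta> > 0" using step by (simp add: is_step_def)
  define F where "F = (\<lambda>t. exp (c / 4 * t) * lyap (X x v a t) (V x v a t))"
  have "(F has_real_derivative exp (c / 4 * t) *
      (lyap_rate (gh x v a) (X x v a t) (V x v a t) + c / 4 * lyap (X x v a t) (V x v a t))) (at t)" for t
    unfolding F_def by (auto intro!: derivative_eq_intros lyap_has_derivative simp: algebra_simps)
  then have "((\<lambda>t. exp (c / 4 * t) * (lyap_rate (gh x v a) (X x v a t) (V x v a t)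
      + c / 4 * lyap (X x v a t) (V x v a t))) has_integral F \<Delta> - F 0) {0..\<Delta>}"
    using \<Delta> by (intro fundamental_theorem_of_calculus)
      (auto simp: has_real_derivative_iff_has_vector_derivative[symmetric] intro: has_field_derivative_at_within)
  then have "F \<Delta> - F 0 \<le> integral {0..\<Delta>} (\<lambda>z. exp (c / 4 * z) * bd bnd x v a z)"
    by (rule has_integral_le[OF _ integrable_integral[OF weighted_bd_integrable]])
      (intro mult_left_mono lyap_rate_le_bd, auto)
  also have "\<dots> \<le> 0"
  proof (cases trg)
    case Perf
    then show ?thesis using step bf_Perf[of bnd x v a \<Delta>] by (simp add: is_step_def)
  next
    case Deriv
    have "integral {0..\<Delta>} (\<lambda>z. exp (c / 4 * z) * bd bnd x v a z) \<le> integral {0..\<Delta>} (\<lambda>z. 0)"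
      using Deriv_step_bd_nonpos[OF C step[unfolded Deriv]]
      by (intro integral_le weighted_bd_integrable) (auto simp: mult_le_0_iff)
    then show ?thesis by simp
  qed
  finally have "F \<Delta> \<le> lyap x v" by (simp add: F_def hoh_initial)
  then have "exp (- (c / 4) * \<Delta>) * F \<Delta> \<le> exp (- (c / 4) * \<Delta>) * lyap x v"
    by (intro mult_left_mono) auto
  moreover have "exp (- (c / 4) * \<Delta>) * F \<Delta> = lyap (X x v a \<Delta>) (V x v a \<Delta>)"
    by (simp add: F_def mult.assoc[symmetric] exp_add[symmetric])
  ultimately show ?thesis by (simp only:)
qed

lemma gap_le_lyap: "f x - f xs \<le> lyap x v / q"
proof -
  have "q * (f x - f xs) \<le> lyap x v" by (simp add: lyap_def)
  then show ?thesis using q_gt_1 by (simp add: field_simps)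
qed

lemma hoh_run_stepD:
  assumes "hoh_run \<mu> L s f trg bnd x0 v0 \<epsilon> ri rd \<tau> a0 N Xs Vs P H" "k < N"
  obtains m where "search_stops \<mu> L s f trg bnd \<tau> rd (Xs k) (Vs k) (P k) m"
    "step trg bnd (Xs k) (Vs k) (P k * rd ^ m) (H k)"
    "Xs (Suc k) = X (Xs k) (Vs k) (P k * rd ^ m) (H k)"
    "Vs (Suc k) = V (Xs k) (Vs k) (P k * rd ^ m) (H k)"
    "P (Suc k) = (if m = 0 then P k * rd ^ m * ri else P k * rd ^ m)"
  using assms unfolding hoh_run_def Let_def by blast

lemma hoh_run_parameter_nonneg:
  assumes run: "hoh_run \<mu> L s f trg bnd x0 v0 \<epsilon> ri rd \<tau> a0 N Xs Vs P H"
    and "ri > 1" "0 < rd" "a0 \<ge> 0" and "k \<le> N"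
  shows "P k \<ge> 0"
  using \<open>k \<le> N\<close>
proof (induction k)
  case 0
  then show ?case using run assms(4) by (simp add: hoh_run_def)
next
  case (Suc k)
  then obtain m where "P (Suc k) = (if m = 0 then P k * rd ^ m * ri else P k * rd ^ m)"
    using hoh_run_stepD[OF run, of k] by (metis Suc_le_lessD)
  then show ?case using Suc assms by simp
qed

text \<open>The search guarantees some stepsize that is at least \<open>\<tau>\<close>; uniqueness
  identifies it with the one taken.\<close>

lemma hoh_run_step_ge:
  assumes run: "hoh_run \<mu> L s f trg bnd x0 v0 \<epsilon> ri rd \<tau> a0 N Xs Vs P H" and "k < N"
  shows "H k \<ge> \<tau>"
  using hoh_run_stepD[OF assms] is_step_unique unfolding search_stops_def accepts_def by metis

lemma hoh_run_lyap_le: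
  assumes run: "hoh_run \<mu> L s f trg bnd x0 v0 \<epsilon> ri rd \<tau> a0 N Xs Vs P H" and "k \<le> N"
  shows "lyap (Xs k) (Vs k) \<le> exp (- (c / 4) * (\<Sum>i<k. H i)) * lyap x0 v0"
  using \<open>k \<le> N\<close>
proof (induction k)
  case 0
  then show ?case using run by (simp add: hoh_run_def)
next
  case (Suc k)
  obtain m where m: "search_stops \<mu> L s f trg bnd \<tau> rd (Xs k) (Vs k) (P k) m"
    "step trg bnd (Xs k) (Vs k) (P k * rd ^ m) (H k)"
    "Xs (Suc k) = X (Xs k) (Vs k) (P k * rd ^ m) (H k)"
    "Vs (Suc k) = V (Xs k) (Vs k) (P k * rd ^ m) (H k)"
    using hoh_run_stepD[OF run] Suc.prems by (metis Suc_le_lessD)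
  have "lyap (Xs (Suc k)) (Vs (Suc k)) \<le> exp (- (c / 4) * H k) * lyap (Xs k) (Vs k)"
    unfolding m(3,4) using m(1,2) by (intro lyap_decay) (auto simp: search_stops_def accepts_def)
  also have "\<dots> \<le> exp (- (c / 4) * H k) * (exp (- (c / 4) * (\<Sum>i<k. H i)) * lyap x0 v0)"
    using Suc.prems by (intro mult_left_mono Suc.IH) auto
  also have "\<dots> = exp (- (c / 4) * H k + - (c / 4) * (\<Sum>i<k. H i)) * lyap x0 v0"
    by (simp only: exp_add mult.assoc)
  also have "- (c / 4) * H k + - (c / 4) * (\<Sum>i<k. H i) = - (c / 4) * (\<Sum>i<Suc k. H i)"
    by (simp add: algebra_simps)
  finally show ?case .
qed

text \<open>Executability concerns the iteration that follows a run of length \<open>N\<close>; as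
  \<open>N\<close> is arbitrary, this covers every iteration.\<close>

lemma hoh_run_properties:
  assumes run: "hoh_run \<mu> L s f trg bnd x0 v0 \<epsilon> ri rd \<tau> a0 N Xs Vs P H"
    and "\<epsilon> > 0" "ri > 1" "0 < rd" "rd < 1" "\<tau> \<le> MIET" "a0 \<ge> 0"
  shows "norm (G (Xs N)) \<ge> \<epsilon> \<Longrightarrow> \<exists>m. search_stops \<mu> L s f trg bnd \<tau> rd (Xs N) (Vs N) (P N) m"
    and "k < N \<Longrightarrow> H k \<ge> \<tau>"
    and "k < N \<Longrightarrow> f (Xs (Suc k)) - f xs \<le> lyap x0 v0 / q * exp (- (sqrt \<mu> / 4) * (\<Sum>i\<le>k. H i))"
proof -
  show "\<exists>m. search_stops \<mu> L s f trg bnd \<tau> rd (Xs N) (Vs N) (P N) m" if "norm (G (Xs N)) \<ge> \<epsilon>"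
    using that assms hoh_run_parameter_nonneg[OF run] by (intro search_stops_exists) auto
  show "H k \<ge> \<tau>" if "k < N" using hoh_run_step_ge[OF run that] .
  show "f (Xs (Suc k)) - f xs \<le> lyap x0 v0 / q * exp (- (sqrt \<mu> / 4) * (\<Sum>i\<le>k. H i))" if "k < N"
  proof -
    have "f (Xs (Suc k)) - f xs \<le> lyap (Xs (Suc k)) (Vs (Suc k)) / q" by (rule gap_le_lyap)
    also have "\<dots> \<le> exp (- (c / 4) * (\<Sum>i<Suc k. H i)) * lyap x0 v0 / q"
      using hoh_run_lyap_le[OF run, of "Suc k"] that q_gt_1 by (intro divide_right_mono) auto
    finally show ?thesis by (simp add: c_def lessThan_Suc_atMost mult.commute)
  qed
qed

end

theorem propositionV4:
  fixes \<mu> L s :: real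
  assumes "\<mu> > 0" and "L > 0" and "s > 0"
  shows "\<forall>trg. \<exists>MIET>0. \<forall>bnd. \<forall>(f :: real ^ 'n \<Rightarrow> real) xs.
    (\<forall>x. f differentiable (at x)) \<and> continuous_on UNIV (grad f) \<and>
    strongly_convex \<mu> f \<and> L-lipschitz_on UNIV (grad f) \<and> (\<forall>y. f xs \<le> f y) \<longrightarrow>
    (\<forall>x0 v0. \<exists>K. \<forall>\<epsilon>>0. \<forall>ri>1. \<forall>rd. 0 < rd \<and> rd < 1 \<longrightarrow> (\<forall>\<tau>\<le>MIET. \<forall>a0\<ge>0. \<forall>N X V P H.
      hoh_run \<mu> L s f trg bnd x0 v0 \<epsilon> ri rd \<tau> a0 N X V P H \<longrightarrow>
        (norm (grad f (X N)) \<ge> \<epsilon> \<longrightarrow>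
           (\<exists>m. search_stops \<mu> L s f trg bnd \<tau> rd (X N) (V N) (P N) m)) \<and>
        (\<forall>k<N. H k \<ge> \<tau>) \<and>
        (\<forall>k<N. f (X (Suc k)) - f xs \<le> K * exp (- (sqrt \<mu> / 4) * (\<Sum>i\<le>k. H i)))))"
proof -
  \<comment> \<open>The constants are fixed before \<open>f\<close> and the bound are introduced, so
    \<open>MIET\<close> cannot depend on them; the same value serves both triggers.\<close>
  interpret hoh_params \<mu> L s "sqrt \<mu>" "sqrt (mu_s \<mu> s)"
    using assms by unfold_locales auto
  show ?thesis
  proof (rule allI, rule exI[of _ MIET], rule conjI[OF const_pos(5)], intro allI impI, goal_cases)
    case (1 trg bnd f xs x0 v0)
    then interpret smooth_strongly_convex \<mu> L s "sqrt \<mu>" "sqrt (mu_s \<mu> s)" f xs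
      by unfold_locales auto
    show ?case
      by (intro exI[of _ "lyap x0 v0 / sqrt (mu_s \<mu> s)"] allI impI conjI; (elim conjE)?;
          rule hoh_run_properties; assumption)
  qed
qed

end
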